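(* Let $Q$ be an acyclic quiver, let $v\in Q_0$ be a source, and let $\mathbf{d}\in\mathbb{Z}_{\geq 0}^{Q_0}$ with $d_v=d$. Let $\{\mathcal{A},\mathcal{B}\}$ be a partition of the set $\{\alpha\in Q_1 \mid s(\alpha)=v\}$ of arrows with source vertex $v$. Define a quiver $\overline{Q}=(\overline{Q}_0,\overline{Q}_1)$ by splitting $v$ into two new distinct vertices $v^{\mathcal{A}},v^{\mathcal{B}}$: $\overline{Q}_0:=(Q_0\setminus\{v\})\cup\{v^{\mathcal{A}},v^{\mathcal{B}}\}$, $\overline{\mathcal{A}}:=\{\overline{\alpha}: v^{\mathcal{A}}\to t(\alpha) \mid \alpha\in\mathcal{A}\}$, $\overline{\mathcal{B}}:=\{\overline{\beta}: v^{\mathcal{B}}\to t(\beta) \mid \beta\in\mathcal{B}\}$, and $\overline{Q}_1:=(Q_1\setminus(\mathcal{A}\cup\mathcal{B}))\cup\overline{\mathcal{A}}\cup\overline{\mathcal{B}}$. Define $\overline{\mathbf{d}}\in\mathbb{Z}_{\geq 0}^{\overline{Q}_0}$ by $\overline{d}_{v^{\mathcal{A}}}=\overline{d}_{v^{\mathcal{B}}}=d$ and $\overline{d}_i=d_i$ for all $i\in Q_0\setminus\{v\}$. Then $\operatorname{rad}A_{Q,\mathbf{d}}\cong\operatorname{rad}A_{\overline{Q},\overline{\mathbf{d}}}$ (as ideals, in the sense defined in the context). In particular, $[Q,\mathbf{d}]=[\overline{Q},\overline{\mathbf{d}}]$.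
   Context: Let $\mathbb{k}=\mathbb{F}_q$ be a finite field. A quiver $Q=(Q_0,Q_1)$ consists of a finite set $Q_0$ of vertices and a finite set $Q_1$ of arrows, each arrow $\alpha$ having a source $s(\alpha)$ and a target $t(\alpha)$ in $Q_0$; multiple arrows are allowed. $Q$ is acyclic if it has no oriented cycles. A source is a vertex that is the target of no arrow; a sink is a vertex that is the source of no arrow. Paths are written left to right ($cp$ means first $c$, then $p$). For a vertex $i$, $P_Q(i)$ is the indecomposable projective representation of $Q$ over $\mathbb{k}$ at $i$: its space at vertex $j$ has as basis the set of all paths from $i$ to $j$ (including the constant path $e_i$ if $j=i$), and an arrow $\alpha:j\to k$ acts by $c\mapsto c\alpha$. For a summand vector $\mathbf{d}\in\mathbb{Z}_{\geq 0}^{Q_0}$, $P_{Q,\mathbf{d}}:=\bigoplus_{i\in Q_0}P_Q(i)^{d_i}$ and $A_{Q,\mathbf{d}}:=\operatorname{End}(P_{Q,\mathbf{d}})$ is its endomorphism algebra in the category of representations of $Q$ over $\mathbb{k}$. $\operatorname{rad}$ denotes the Jacobson radical. The count $[Q,\mathbf{d}]$ is the number of pairs $(x,y)\in\operatorname{rad}A_{Q,\mathbf{d}}\times\operatorname{rad}A_{Q,\mathbf{d}}$ with $xy=yx$. Two-sided ideals $I\unlhd A$, $J\unlhd B$ of $\mathbb{k}$-algebras are called isomorphic, $I\cong J$, if there is a bijective $\mathbb{k}$-linear map $\Psi:I\to J$ with $\Psi(i_1 i_2)=\Psi(i_1)\Psi(i_2)$ for all $i_1,i_2\in I$. *)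

theory Defs
  imports "HOL-Algebra.Module" "HOL-Algebra.Ideal" "Graph_Theory.Arc_Walk"
begin

text \<open>
  A quiver is a \<^term>\<open>fin_digraph\<close> (loops and multiple arcs are allowed), an arrow \<open>a\<close> going
  from \<open>tail Q a\<close> to \<open>head Q a\<close>. A path is an \<open>awalk\<close>, i.e. the list of its arrows read from
  left to right; the constant path \<open>e\<^sub>i\<close> is the walk \<open>[]\<close> from \<open>i\<close> to \<open>i\<close>.
  Scalars form a field \<open>K\<close> in the sense of HOL-Algebra.
\<close>

definition paths :: "('v, 'e) pre_digraph \<Rightarrow> 'v \<Rightarrow> 'v \<Rightarrow> 'e list set" where
  "paths Q i j = {p. pre_digraph.awalk Q i p j}"


section \<open>Vector spaces and linear maps\<close>

text \<open>
  All carriers below consist of extensional functions, so that equality of vectors and of maps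
  is equality of functions. The ring multiplication and unit of a \<^term>\<open>module\<close> record are
  irrelevant for a vector space and are left unspecified.
\<close>

definition free_module :: "('k, 'r) ring_scheme \<Rightarrow> 'b set \<Rightarrow> ('k, 'b \<Rightarrow> 'k) module" where
  "free_module K B =
    \<lparr>carrier = {f \<in> (\<Pi>\<^sub>E b\<in>B. carrier K). finite {b \<in> B. f b \<noteq> \<zero>\<^bsub>K\<^esub>}},
     mult = undefined, one = undefined,
     zero = (\<lambda>b\<in>B. \<zero>\<^bsub>K\<^esub>),
     add = (\<lambda>f g. \<lambda>b\<in>B. f b \<oplus>\<^bsub>K\<^esub> g b),
     smult = (\<lambda>c f. \<lambda>b\<in>B. c \<otimes>\<^bsub>K\<^esub> f b)\<rparr>"

text \<open>The direct sum of a family of modules over a \<^emph>\<open>finite\<close> index set.\<close>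

definition fin_direct_sum :: "'x set \<Rightarrow> ('x \<Rightarrow> ('k, 'm) module) \<Rightarrow> ('k, 'x \<Rightarrow> 'm) module" where
  "fin_direct_sum X M =
    \<lparr>carrier = (\<Pi>\<^sub>E x\<in>X. carrier (M x)),
     mult = undefined, one = undefined,
     zero = (\<lambda>x\<in>X. \<zero>\<^bsub>M x\<^esub>),
     add = (\<lambda>f g. \<lambda>x\<in>X. f x \<oplus>\<^bsub>M x\<^esub> g x),
     smult = (\<lambda>c f. \<lambda>x\<in>X. c \<odot>\<^bsub>M x\<^esub> f x)\<rparr>"

definition linear_maps ::
  "('k, 'r) ring_scheme \<Rightarrow> ('k, 'm) module \<Rightarrow> ('k, 'n) module \<Rightarrow> ('m \<Rightarrow> 'n) set" where
  "linear_maps K M N =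
    {f \<in> (\<Pi>\<^sub>E x\<in>carrier M. carrier N).
       (\<forall>x\<in>carrier M. \<forall>y\<in>carrier M. f (x \<oplus>\<^bsub>M\<^esub> y) = f x \<oplus>\<^bsub>N\<^esub> f y) \<and>
       (\<forall>c\<in>carrier K. \<forall>x\<in>carrier M. f (c \<odot>\<^bsub>M\<^esub> x) = c \<odot>\<^bsub>N\<^esub> f x)}"


section \<open>Representations of quivers\<close>

record ('k, 'v, 'e, 'm) quiver_rep =
  vspace :: "'v \<Rightarrow> ('k, 'm) module"
  action :: "'e \<Rightarrow> 'm \<Rightarrow> 'm"

definition is_quiver_rep ::
  "('k, 'r) ring_scheme \<Rightarrow> ('v, 'e) pre_digraph \<Rightarrow> ('k, 'v, 'e, 'm) quiver_rep \<Rightarrow> bool" where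
  "is_quiver_rep K Q V \<longleftrightarrow>
    (\<forall>j\<in>verts Q. Module.module K (vspace V j)) \<and>
    (\<forall>a\<in>arcs Q. action V a \<in> linear_maps K (vspace V (tail Q a)) (vspace V (head Q a)))"

definition rep_hom ::
  "('k, 'r) ring_scheme \<Rightarrow> ('v, 'e) pre_digraph \<Rightarrow> ('k, 'v, 'e, 'm) quiver_rep
    \<Rightarrow> ('k, 'v, 'e, 'n) quiver_rep \<Rightarrow> ('v \<Rightarrow> 'm \<Rightarrow> 'n) set" where
  "rep_hom K Q V W =
    {f \<in> (\<Pi>\<^sub>E j\<in>verts Q. linear_maps K (vspace V j) (vspace W j)).
       \<forall>a\<in>arcs Q. \<forall>x\<in>carrier (vspace V (tail Q a)).
         f (head Q a) (action V a x) = action W a (f (tail Q a) x)}"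

text \<open>The endomorphism algebra; its product is composition of maps, \<open>f g = f \<circ> g\<close>.\<close>

definition End_algebra ::
  "('k, 'r) ring_scheme \<Rightarrow> ('v, 'e) pre_digraph \<Rightarrow> ('k, 'v, 'e, 'm) quiver_rep
    \<Rightarrow> ('k, 'v \<Rightarrow> 'm \<Rightarrow> 'm) module" where
  "End_algebra K Q V =
    \<lparr>carrier = rep_hom K Q V V,
     mult = (\<lambda>f g. \<lambda>j\<in>verts Q. \<lambda>x\<in>carrier (vspace V j). f j (g j x)),
     one = (\<lambda>j\<in>verts Q. \<lambda>x\<in>carrier (vspace V j). x),
     zero = (\<lambda>j\<in>verts Q. \<lambda>x\<in>carrier (vspace V j). \<zero>\<^bsub>vspace V j\<^esub>),
     add = (\<lambda>f g. \<lambda>j\<in>verts Q. \<lambda>x\<in>carrier (vspace V j). f j x \<oplus>\<^bsub>vspace V j\<^esub> g j x),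
     smult = (\<lambda>c f. \<lambda>j\<in>verts Q. \<lambda>x\<in>carrier (vspace V j). c \<odot>\<^bsub>vspace V j\<^esub> f j x)\<rparr>"

definition rep_direct_sum ::
  "('v, 'e) pre_digraph \<Rightarrow> 'x set \<Rightarrow> ('x \<Rightarrow> ('k, 'v, 'e, 'm) quiver_rep)
    \<Rightarrow> ('k, 'v, 'e, 'x \<Rightarrow> 'm) quiver_rep" where
  "rep_direct_sum Q X V =
    \<lparr>vspace = (\<lambda>j. fin_direct_sum X (\<lambda>x. vspace (V x) j)),
     action = (\<lambda>a. \<lambda>f\<in>carrier (fin_direct_sum X (\<lambda>x. vspace (V x) (tail Q a))).
       \<lambda>x\<in>X. action (V x) a (f x))\<rparr>"

text \<open>
  The projective representation \<open>P\<^sub>Q(i)\<close>. Its space at \<open>j\<close> has the paths from \<open>i\<close> to \<open>j\<close> as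
  basis, and an arrow \<open>a\<close> sends the basis vector \<open>c\<close> to the basis vector \<open>c @ [a]\<close>. In
  coordinates: the coefficient of the image of \<open>f\<close> at a path \<open>p\<close> is \<open>f c\<close> if \<open>p = c @ [a]\<close>,
  and zero if \<open>p\<close> does not end with \<open>a\<close>.
\<close>

definition proj_rep ::
  "('k, 'r) ring_scheme \<Rightarrow> ('v, 'e) pre_digraph \<Rightarrow> 'v \<Rightarrow> ('k, 'v, 'e, 'e list \<Rightarrow> 'k) quiver_rep"
  where
  "proj_rep K Q i =
    \<lparr>vspace = (\<lambda>j. free_module K (paths Q i j)),
     action = (\<lambda>a. \<lambda>f\<in>carrier (free_module K (paths Q i (tail Q a))).
       \<lambda>p\<in>paths Q i (head Q a).
         if p \<noteq> [] \<and> last p = a then f (butlast p) else \<zero>\<^bsub>K\<^esub>)\<rparr>"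

text \<open>The pair \<open>(i, r)\<close> with \<open>r < d i\<close> indexes the copies of \<open>P\<^sub>Q(i)\<close> in \<open>P\<^sub>Q\<^sub>,\<^sub>d\<close>.\<close>

definition proj_sum ::
  "('k, 'r) ring_scheme \<Rightarrow> ('v, 'e) pre_digraph \<Rightarrow> ('v \<Rightarrow> nat)
    \<Rightarrow> ('k, 'v, 'e, 'v \<times> nat \<Rightarrow> 'e list \<Rightarrow> 'k) quiver_rep" where
  "proj_sum K Q d = rep_direct_sum Q (SIGMA i:verts Q. {..<d i}) (\<lambda>(i, r). proj_rep K Q i)"

definition A_alg ::
  "('k, 'r) ring_scheme \<Rightarrow> ('v, 'e) pre_digraph \<Rightarrow> ('v \<Rightarrow> nat)
    \<Rightarrow> ('k, 'v \<Rightarrow> ('v \<times> nat \<Rightarrow> 'e list \<Rightarrow> 'k) \<Rightarrow> 'v \<times> nat \<Rightarrow> 'e list \<Rightarrow> 'k) module" where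
  "A_alg K Q d = End_algebra K Q (proj_sum K Q d)"


section \<open>Jacobson radical, commuting pairs, isomorphism of ideals\<close>

definition left_ideal :: "'a set \<Rightarrow> ('a, 'b) ring_scheme \<Rightarrow> bool" where
  "left_ideal I R \<longleftrightarrow>
    additive_subgroup I R \<and> (\<forall>r\<in>carrier R. \<forall>x\<in>I. r \<otimes>\<^bsub>R\<^esub> x \<in> I)"

definition maximal_left_ideal :: "'a set \<Rightarrow> ('a, 'b) ring_scheme \<Rightarrow> bool" where
  "maximal_left_ideal I R \<longleftrightarrow>
    left_ideal I R \<and> I \<noteq> carrier R \<and>
    (\<forall>J. left_ideal J R \<longrightarrow> I \<subseteq> J \<longrightarrow> J = I \<or> J = carrier R)"

definition jacobson_radical :: "('a, 'b) ring_scheme \<Rightarrow> 'a set" where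
  "jacobson_radical R = {x \<in> carrier R. \<forall>I. maximal_left_ideal I R \<longrightarrow> x \<in> I}"

definition commuting_rad_count ::
  "('k, 'r) ring_scheme \<Rightarrow> ('v, 'e) pre_digraph \<Rightarrow> ('v \<Rightarrow> nat) \<Rightarrow> nat" where
  "commuting_rad_count K Q d =
    card {(x, y). x \<in> jacobson_radical (A_alg K Q d) \<and> y \<in> jacobson_radical (A_alg K Q d) \<and>
      x \<otimes>\<^bsub>A_alg K Q d\<^esub> y = y \<otimes>\<^bsub>A_alg K Q d\<^esub> x}"

text \<open>Isomorphism of ideals \<open>I\<close> of \<open>A\<close> and \<open>J\<close> of \<open>B\<close>, as algebras without unit over \<open>K\<close>.\<close>

definition ideals_isomorphic ::
  "('k, 'r) ring_scheme \<Rightarrow> ('k, 'a) module \<Rightarrow> 'a set \<Rightarrow> ('k, 'b) module \<Rightarrow> 'b set \<Rightarrow> bool" where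
  "ideals_isomorphic K A I B J \<longleftrightarrow>
    (\<exists>\<Psi>. bij_betw \<Psi> I J \<and>
      (\<forall>x\<in>I. \<forall>y\<in>I. \<Psi> (x \<oplus>\<^bsub>A\<^esub> y) = \<Psi> x \<oplus>\<^bsub>B\<^esub> \<Psi> y) \<and>
      (\<forall>c\<in>carrier K. \<forall>x\<in>I. \<Psi> (c \<odot>\<^bsub>A\<^esub> x) = c \<odot>\<^bsub>B\<^esub> \<Psi> x) \<and>
      (\<forall>x\<in>I. \<forall>y\<in>I. \<Psi> (x \<otimes>\<^bsub>A\<^esub> y) = \<Psi> x \<otimes>\<^bsub>B\<^esub> \<Psi> y))"


section \<open>Splitting a vertex\<close>

datatype 'v split_vertex = Old 'v | SplitA | SplitB

datatype 'e split_arrow = Kept 'e | Bar 'e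

text \<open>
  The two blocks are disjoint, so the arrow \<open>Bar a\<close> starts at \<open>SplitB\<close> exactly when \<open>a\<close>
  is in \<open>B\<close>.
\<close>

definition split_quiver ::
  "('v, 'e) pre_digraph \<Rightarrow> 'v \<Rightarrow> 'e set \<Rightarrow> 'e set
    \<Rightarrow> ('v split_vertex, 'e split_arrow) pre_digraph" where
  "split_quiver Q v A B =
    \<lparr>verts = Old ` (verts Q - {v}) \<union> {SplitA, SplitB},
     arcs = Kept ` (arcs Q - (A \<union> B)) \<union> Bar ` A \<union> Bar ` B,
     tail = (\<lambda>e. case e of Kept a \<Rightarrow> Old (tail Q a)
                  | Bar a \<Rightarrow> (if a \<in> A then SplitA else SplitB)),
     head = (\<lambda>e. case e of Kept a \<Rightarrow> Old (head Q a) | Bar a \<Rightarrow> Old (head Q a))\<rparr>"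

definition split_dim :: "'v \<Rightarrow> ('v \<Rightarrow> nat) \<Rightarrow> 'v split_vertex \<Rightarrow> nat" where
  "split_dim v d w = (case w of Old i \<Rightarrow> d i | SplitA \<Rightarrow> d v | SplitB \<Rightarrow> d v)"

end

theory Submission
  imports Defs
begin

text \<open>
  The radical of \<open>End(P\<^sub>Q\<^sub>,\<^sub>d)\<close> consists of the endomorphisms whose images have no component
  along constant paths: these are nilpotent because path lengths are bounded, and for a vector
  \<open>x\<close> with a nonzero component along a constant path, the maps \<open>g\<close> for which \<open>g x\<close> has none form
  a maximal left ideal. At a source \<open>v\<close> only constant paths end, so a radical endomorphism
  vanishes on the fibre at \<open>v\<close>. A path of \<open>Q\<close> ending at the image of a vertex \<open>w\<close> of the split
  quiver lifts uniquely to a path ending at \<open>w\<close>; hence the fibres of the two projective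
  representations at corresponding vertices are identified compatibly with all arrows.
  Conjugation by these identifications is an isomorphism of the radicals: separating the two
  copies of \<open>v\<close> adds no freedom, since all maps are zero there.
\<close>

section \<open>Nil left ideals\<close>

text \<open>The algebras themselves differ in dimension by \<open>d v\<close> squared: the constant
  paths at \<open>v\<close> are counted twice after the splitting, all other paths once. So for
  \<open>d v > 0\<close> the isomorphism cannot come from an isomorphism of the algebras, and it has
  to be built on the radicals alone. The definition by maximal left ideals says little about
  individual elements; hence the radical is determined as an explicit set of maps, in a locale that
  is then instantiated for both quivers. The obstacle is the way back. A map on the split side has
  two components over \<open>v\<close>, at \<open>SplitA\<close> and at \<open>SplitB\<close>, which
  are unrelated in general, while a map of \<open>P\<close> has room for one. Choosing the component
  at \<open>SplitA\<close> would break the compatibility with the arrows of \<open>B\<close>, which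
  start at \<open>SplitB\<close>; that radical maps vanish at both copies removes the
  conflict.\<close>

text \<open>Negatives come from multiplication by \<open>\<ominus> \<one>\<close>, so closure under
  sums and left multiples suffices.\<close>

lemma left_idealI:
  fixes R (structure)
  assumes "ring R" "I \<subseteq> carrier R" "I \<noteq> {}"
    and add: "\<And>x y. x \<in> I \<Longrightarrow> y \<in> I \<Longrightarrow> x \<oplus> y \<in> I"
    and mult: "\<And>r x. r \<in> carrier R \<Longrightarrow> x \<in> I \<Longrightarrow> r \<otimes> x \<in> I"
  shows "left_ideal I R"
proof -
  interpret ring R by fact
  have "subgroup I (add_monoid R)"
  proof (rule add.subgroupI)
    fix x assume "x \<in> I"
    then show "\<ominus> x \<in> I"
      using mult[of "\<ominus> \<one>" x] assms(2) by (auto simp: l_minus)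
  qed (use assms in auto)
  then show ?thesis
    unfolding left_ideal_def by (blast intro: mult additive_subgroup.intro)
qed

context ring
begin

lemma left_idealD:
  assumes "left_ideal I R"
  shows "I \<subseteq> carrier R" "\<zero> \<in> I"
    "\<And>x y. x \<in> I \<Longrightarrow> y \<in> I \<Longrightarrow> x \<oplus> y \<in> I"
    "\<And>r x. r \<in> carrier R \<Longrightarrow> x \<in> I \<Longrightarrow> r \<otimes> x \<in> I"
  using assms unfolding left_ideal_def
  by (auto intro: additive_subgroup.a_closed additive_subgroup.zero_closed
      dest: additive_subgroup.a_subset)

lemma left_ideal_one:
  assumes "left_ideal I R" "\<one> \<in> I"
  shows "I = carrier R"
  using left_idealD(1,4)[OF assms(1)] assms(2) by (metis r_one subset_antisym subsetI)

text \<open>If \<open>x\<close> escapes a maximal left ideal \<open>I\<close>, then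
  \<open>\<one> = m \<oplus> h\<close> with \<open>m\<close> in \<open>I\<close> and
  \<open>h\<close> a left multiple of \<open>x\<close>. As \<open>h\<close> is nilpotent,
  \<open>\<one> \<ominus> h\<close> is a unit lying in \<open>I\<close>, which is absurd.\<close>

lemma nil_left_ideal_subset_jacobson_radical:
  assumes N: "N \<subseteq> carrier R"
    and mult: "\<And>r x. r \<in> carrier R \<Longrightarrow> x \<in> N \<Longrightarrow> r \<otimes> x \<in> N"
    and nil: "\<And>x. x \<in> N \<Longrightarrow> \<exists>n::nat. x [^] n = \<zero>"
  shows "N \<subseteq> jacobson_radical R"
proof
  fix x assume x: "x \<in> N"
  then have xc: "x \<in> carrier R" using N by blast
  have "x \<in> I" if max: "maximal_left_ideal I R" for I
  proof (rule ccontr)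
    assume "x \<notin> I"
    have I: "left_ideal I R" using max by (simp add: maximal_left_ideal_def)
    note I_simps = left_idealD[OF I]
    have Ic: "m \<in> carrier R" if "m \<in> I" for m using that I_simps(1) by blast
    \<comment> \<open>The left ideal generated by \<open>I\<close> and \<open>x\<close>; by
      maximality it is everything.\<close>
    define J where "J = {m \<oplus> g \<otimes> x | m g. m \<in> I \<and> g \<in> carrier R}"
    have "left_ideal J R"
    proof (rule left_idealI)
      show "J \<subseteq> carrier R" using xc Ic by (auto simp: J_def)
      show "J \<noteq> {}" using I_simps(2) by (auto simp: J_def)
    next
      fix y z assume "y \<in> J" "z \<in> J"
      then obtain m g m' g' where *: "m \<in> I" "g \<in> carrier R" "y = m \<oplus> g \<otimes> x"
        "m' \<in> I" "g' \<in> carrier R" "z = m' \<oplus> g' \<otimes> x"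
        unfolding J_def by blast
      then have "y \<oplus> z = (m \<oplus> m') \<oplus> (g \<oplus> g') \<otimes> x"
        using xc Ic by (simp add: l_distr a_ac)
      then show "y \<oplus> z \<in> J"
        using * I_simps(3) unfolding J_def by blast
    next
      fix r y assume r: "r \<in> carrier R" and "y \<in> J"
      then obtain m g where *: "m \<in> I" "g \<in> carrier R" "y = m \<oplus> g \<otimes> x"
        unfolding J_def by blast
      then have "r \<otimes> y = r \<otimes> m \<oplus> (r \<otimes> g) \<otimes> x"
        using xc Ic r by (simp add: r_distr m_assoc)
      then show "r \<otimes> y \<in> J"
        using * I_simps(4) r unfolding J_def by blast
    qed (rule ring_axioms)
    moreover have "I \<subseteq> J"
    proof
      fix m assume "m \<in> I"
      moreover from this have "m = m \<oplus> \<zero> \<otimes> x" using xc Ic by simp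
      ultimately show "m \<in> J" unfolding J_def by blast
    qed
    moreover have "x = \<zero> \<oplus> \<one> \<otimes> x" using xc by simp
    then have "x \<in> J" using I_simps(2) unfolding J_def by blast
    ultimately have "J = carrier R"
      using max \<open>x \<notin> I\<close> unfolding maximal_left_ideal_def by blast
    then have "\<one> \<in> J" by simp
    then obtain m g where mg: "m \<in> I" "g \<in> carrier R" "\<one> = m \<oplus> g \<otimes> x"
      unfolding J_def by blast
    define h where "h = g \<otimes> x"
    have hN: "h \<in> N" and h: "h \<in> carrier R" using mult mg(2) x xc by (auto simp: h_def)
    have one_minus: "\<one> \<ominus> h = m"
      using mg Ic h by (simp add: h_def minus_eq a_assoc r_neg)
    \<comment> \<open>Geometric series in telescoped form: each step adds
      \<open>h [^] n \<otimes> (\<one> \<ominus> h)\<close>, a left multiple of \<open>m\<close>.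
      Once the power vanishes, \<open>\<one>\<close> itself lies in \<open>I\<close>.\<close>
    have "\<one> \<ominus> h [^] n \<in> I" for n :: nat
    proof (induction n)
      case 0
      then show ?case using I_simps(2) by (simp add: minus_eq r_neg)
    next
      case (Suc n)
      have "\<one> \<ominus> h [^] Suc n = (\<one> \<ominus> h [^] n) \<oplus> h [^] n \<otimes> (\<one> \<ominus> h)"
        using h by (simp add: minus_eq r_distr r_minus a_assoc[symmetric])
          (simp add: a_assoc l_neg)
      then show ?case
        using Suc I_simps(3,4) mg(1) h by (simp add: one_minus)
    qed
    moreover obtain n :: nat where "h [^] n = \<zero>" using nil hN by blast
    ultimately have "\<one> \<ominus> \<zero> \<in> I" by metis
    then have "\<one> \<in> I" by (simp add: minus_eq)
    then show False
      using left_ideal_one[OF I] max by (simp add: maximal_left_ideal_def)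
  qed
  with xc show "x \<in> jacobson_radical R" by (simp add: jacobson_radical_def)
qed

end

section \<open>Endomorphism rings of representations\<close>

lemma linear_mapsD:
  assumes "f \<in> linear_maps K M N"
  shows "\<And>x. x \<in> carrier M \<Longrightarrow> f x \<in> carrier N"
    "\<And>x y. x \<in> carrier M \<Longrightarrow> y \<in> carrier M \<Longrightarrow> f (x \<oplus>\<^bsub>M\<^esub> y) = f x \<oplus>\<^bsub>N\<^esub> f y"
    "\<And>c x. c \<in> carrier K \<Longrightarrow> x \<in> carrier M \<Longrightarrow> f (c \<odot>\<^bsub>M\<^esub> x) = c \<odot>\<^bsub>N\<^esub> f x"
  using assms unfolding linear_maps_def by auto

lemma linear_maps_zero:
  assumes "Module.module K M" "Module.module K N" "f \<in> linear_maps K M N"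
  shows "f \<zero>\<^bsub>M\<^esub> = \<zero>\<^bsub>N\<^esub>"
proof -
  interpret M: Module.module K M by fact
  interpret N: Module.module K N by fact
  have "f (\<zero>\<^bsub>K\<^esub> \<odot>\<^bsub>M\<^esub> \<zero>\<^bsub>M\<^esub>) = \<zero>\<^bsub>K\<^esub> \<odot>\<^bsub>N\<^esub> f \<zero>\<^bsub>M\<^esub>"
    by (intro linear_mapsD(3)[OF assms(3)]) auto
  then show ?thesis using linear_mapsD(1)[OF assms(3)] by simp
qed

text \<open>The premises also ask for membership of sums, multiples and images under arrows in the
  carriers, because the restricted functions in the conclusion can be evaluated only there.\<close>

lemma rep_homI:
  assumes "\<And>j x. j \<in> verts Q \<Longrightarrow> x \<in> carrier (vspace V j) \<Longrightarrow> F j x \<in> carrier (vspace W j)"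
    and "\<And>j x y. j \<in> verts Q \<Longrightarrow> x \<in> carrier (vspace V j) \<Longrightarrow> y \<in> carrier (vspace V j) \<Longrightarrow>
      x \<oplus>\<^bsub>vspace V j\<^esub> y \<in> carrier (vspace V j) \<and>
      F j (x \<oplus>\<^bsub>vspace V j\<^esub> y) = F j x \<oplus>\<^bsub>vspace W j\<^esub> F j y"
    and "\<And>j c x. j \<in> verts Q \<Longrightarrow> c \<in> carrier K \<Longrightarrow> x \<in> carrier (vspace V j) \<Longrightarrow>
      c \<odot>\<^bsub>vspace V j\<^esub> x \<in> carrier (vspace V j) \<and>
      F j (c \<odot>\<^bsub>vspace V j\<^esub> x) = c \<odot>\<^bsub>vspace W j\<^esub> F j x"
    and "\<And>a x. a \<in> arcs Q \<Longrightarrow> x \<in> carrier (vspace V (tail Q a)) \<Longrightarrow>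
      tail Q a \<in> verts Q \<and> head Q a \<in> verts Q \<and>
      action V a x \<in> carrier (vspace V (head Q a)) \<and>
      F (head Q a) (action V a x) = action W a (F (tail Q a) x)"
  shows "(\<lambda>j\<in>verts Q. \<lambda>x\<in>carrier (vspace V j). F j x) \<in> rep_hom K Q V W"
  using assms by (auto simp: rep_hom_def linear_maps_def)

lemma rep_homD:
  assumes "f \<in> rep_hom K Q V W"
  shows "\<And>j x. j \<in> verts Q \<Longrightarrow> x \<in> carrier (vspace V j) \<Longrightarrow> f j x \<in> carrier (vspace W j)"
    "\<And>j x y. j \<in> verts Q \<Longrightarrow> x \<in> carrier (vspace V j) \<Longrightarrow> y \<in> carrier (vspace V j) \<Longrightarrow>
      f j (x \<oplus>\<^bsub>vspace V j\<^esub> y) = f j x \<oplus>\<^bsub>vspace W j\<^esub> f j y"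
    "\<And>j c x. j \<in> verts Q \<Longrightarrow> c \<in> carrier K \<Longrightarrow> x \<in> carrier (vspace V j) \<Longrightarrow>
      f j (c \<odot>\<^bsub>vspace V j\<^esub> x) = c \<odot>\<^bsub>vspace W j\<^esub> f j x"
    "\<And>a x. a \<in> arcs Q \<Longrightarrow> x \<in> carrier (vspace V (tail Q a)) \<Longrightarrow>
      f (head Q a) (action V a x) = action W a (f (tail Q a) x)"
    "\<And>j. j \<in> verts Q \<Longrightarrow> f j \<in> linear_maps K (vspace V j) (vspace W j)"
  using assms by (auto simp: rep_hom_def linear_maps_def Pi_iff PiE_def)

lemma rep_hom_ext:
  assumes f: "f \<in> rep_hom K Q V W" and g: "g \<in> rep_hom K Q V W"
    and eq: "\<And>j x. j \<in> verts Q \<Longrightarrow> x \<in> carrier (vspace V j) \<Longrightarrow> f j x = g j x"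
  shows "f = g"
proof (rule PiE_ext)
  show "f \<in> (\<Pi>\<^sub>E j\<in>verts Q. linear_maps K (vspace V j) (vspace W j))"
    and "g \<in> (\<Pi>\<^sub>E j\<in>verts Q. linear_maps K (vspace V j) (vspace W j))"
    using f g by (auto simp: rep_hom_def)
next
  fix j assume j: "j \<in> verts Q"
  then have "f j \<in> (\<Pi>\<^sub>E x\<in>carrier (vspace V j). carrier (vspace W j))"
    "g j \<in> (\<Pi>\<^sub>E x\<in>carrier (vspace V j). carrier (vspace W j))"
    using rep_homD(5)[OF f j] rep_homD(5)[OF g j] by (auto simp: linear_maps_def)
  then show "f j = g j" using eq[OF j] by (rule PiE_ext)
qed

lemma End_algebra_simps:
  "carrier (End_algebra K Q V) = rep_hom K Q V V"
  "mult (End_algebra K Q V) f g = (\<lambda>j\<in>verts Q. \<lambda>x\<in>carrier (vspace V j). f j (g j x))"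
  "one (End_algebra K Q V) = (\<lambda>j\<in>verts Q. \<lambda>x\<in>carrier (vspace V j). x)"
  "zero (End_algebra K Q V) = (\<lambda>j\<in>verts Q. \<lambda>x\<in>carrier (vspace V j). \<zero>\<^bsub>vspace V j\<^esub>)"
  "add (End_algebra K Q V) f g =
    (\<lambda>j\<in>verts Q. \<lambda>x\<in>carrier (vspace V j). f j x \<oplus>\<^bsub>vspace V j\<^esub> g j x)"
  "smult (End_algebra K Q V) c f =
    (\<lambda>j\<in>verts Q. \<lambda>x\<in>carrier (vspace V j). c \<odot>\<^bsub>vspace V j\<^esub> f j x)"
  by (simp_all add: End_algebra_def)

locale quiver_representation = wf_digraph Q
  for K :: "('k, 'r) ring_scheme" and Q :: "('v, 'e) pre_digraph"
    and V :: "('k, 'v, 'e, 'm) quiver_rep" +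
  assumes rep: "is_quiver_rep K Q V"
begin

lemma vspace_module: "j \<in> verts Q \<Longrightarrow> Module.module K (vspace V j)"
  using rep by (simp add: is_quiver_rep_def)

lemma action_linear:
  "a \<in> arcs Q \<Longrightarrow> action V a \<in> linear_maps K (vspace V (tail Q a)) (vspace V (head Q a))"
  using rep by (simp add: is_quiver_rep_def)

lemmas vspace_abelian_group = module.axioms(2)[OF vspace_module]

lemmas vspace_closed =
  abelian_groupE(1,2)[OF vspace_abelian_group] module.smult_closed[OF vspace_module]

lemmas End_ext = rep_hom_ext[where K = K and Q = Q and V = V and W = V]

lemma End_closed:
  assumes f: "f \<in> rep_hom K Q V V" and g: "g \<in> rep_hom K Q V V"
  shows "f \<oplus>\<^bsub>End_algebra K Q V\<^esub> g \<in> rep_hom K Q V V"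
    and "f \<otimes>\<^bsub>End_algebra K Q V\<^esub> g \<in> rep_hom K Q V V"
proof -
  show "f \<oplus>\<^bsub>End_algebra K Q V\<^esub> g \<in> rep_hom K Q V V"
    unfolding End_algebra_simps
  proof (rule rep_homI, goal_cases)
    case (1 j x)
    then show ?case by (intro vspace_closed rep_homD(1)[OF f] rep_homD(1)[OF g])
  next
    case (2 j x y)
    interpret abelian_group "vspace V j" using 2 by (intro vspace_abelian_group)
    show ?case using 2
      by (simp add: rep_homD[OF f] rep_homD[OF g] a_ac)
  next
    case (3 j c x)
    interpret Module.module K "vspace V j" using 3 by (intro vspace_module)
    show ?case using 3
      by (simp add: rep_homD[OF f] rep_homD[OF g] smult_r_distr)
  next
    case (4 a x)
    then show ?case
      by (simp add: linear_mapsD[OF action_linear] rep_homD(1,4)[OF f] rep_homD(1,4)[OF g])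
  qed
  show "f \<otimes>\<^bsub>End_algebra K Q V\<^esub> g \<in> rep_hom K Q V V"
    unfolding End_algebra_simps
    by (rule rep_homI)
      (simp_all add: rep_homD(1-4)[OF f] rep_homD(1-4)[OF g] vspace_closed
        linear_mapsD[OF action_linear])
qed

lemma id_rep_hom: "\<one>\<^bsub>End_algebra K Q V\<^esub> \<in> rep_hom K Q V V"
  unfolding End_algebra_simps
  by (rule rep_homI) (simp_all add: vspace_closed linear_mapsD[OF action_linear])

lemma zero_rep_hom: "\<zero>\<^bsub>End_algebra K Q V\<^esub> \<in> rep_hom K Q V V"
  unfolding End_algebra_simps
proof (rule rep_homI, goal_cases)
  case (2 j x y)
  interpret abelian_group "vspace V j" using 2 by (intro vspace_abelian_group)
  show ?case using 2 by simp
next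
  case (3 j c x)
  interpret Module.module K "vspace V j" using 3 by (intro vspace_module)
  show ?case using 3 by simp
next
  case (4 a x)
  then show ?case
    by (simp add: linear_mapsD[OF action_linear]
        linear_maps_zero[OF vspace_module vspace_module action_linear])
qed (simp add: vspace_closed)

lemma ring_End_algebra: "ring (End_algebra K Q V)"
proof (rule ringI)
  let ?A = "End_algebra K Q V"
  show "abelian_group ?A"
  proof (rule abelian_groupI, goal_cases)
    case (1 f g)
    then show ?case using End_closed by (simp add: End_algebra_simps(1))
  next
    case 2
    then show ?case using zero_rep_hom by (simp add: End_algebra_simps(1))
  next
    case (3 f g h)
    then have *: "f \<in> rep_hom K Q V V" "g \<in> rep_hom K Q V V" "h \<in> rep_hom K Q V V"
      by (simp_all add: End_algebra_simps(1))
    show ?case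
    proof (rule End_ext)
      fix j x assume jx: "j \<in> verts Q" "x \<in> carrier (vspace V j)"
      interpret abelian_group "vspace V j" using jx by (intro vspace_abelian_group)
      show "(f \<oplus>\<^bsub>?A\<^esub> g \<oplus>\<^bsub>?A\<^esub> h) j x = (f \<oplus>\<^bsub>?A\<^esub> (g \<oplus>\<^bsub>?A\<^esub> h)) j x"
        using jx * by (simp add: End_algebra_simps rep_homD a_assoc)
    qed (intro End_closed *)+
  next
    case (4 f g)
    then have *: "f \<in> rep_hom K Q V V" "g \<in> rep_hom K Q V V"
      by (simp_all add: End_algebra_simps(1))
    show ?case
    proof (rule End_ext)
      fix j x assume jx: "j \<in> verts Q" "x \<in> carrier (vspace V j)"
      interpret abelian_group "vspace V j" using jx by (intro vspace_abelian_group)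
      show "(f \<oplus>\<^bsub>?A\<^esub> g) j x = (g \<oplus>\<^bsub>?A\<^esub> f) j x"
        using jx * by (simp add: End_algebra_simps rep_homD a_comm)
    qed (intro End_closed *)+
  next
    case (5 f)
    then have *: "f \<in> rep_hom K Q V V" by (simp_all add: End_algebra_simps(1))
    show ?case
    proof (rule End_ext)
      fix j x assume jx: "j \<in> verts Q" "x \<in> carrier (vspace V j)"
      interpret abelian_group "vspace V j" using jx by (intro vspace_abelian_group)
      show "(\<zero>\<^bsub>?A\<^esub> \<oplus>\<^bsub>?A\<^esub> f) j x = f j x"
        using jx * by (simp add: End_algebra_simps rep_homD)
    qed (intro End_closed zero_rep_hom *)+
  next
    case (6 f)
    then have f: "f \<in> rep_hom K Q V V" by (simp_all add: End_algebra_simps(1))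
    define g where "g = (\<lambda>j\<in>verts Q. \<lambda>x\<in>carrier (vspace V j). \<ominus>\<^bsub>vspace V j\<^esub> f j x)"
    have "g \<in> rep_hom K Q V V"
      unfolding g_def
    proof (rule rep_homI, goal_cases)
      case (1 j x)
      interpret abelian_group "vspace V j" using 1 by (intro vspace_abelian_group)
      show ?case using 1 by (simp add: rep_homD[OF f])
    next
      case (2 j x y)
      interpret abelian_group "vspace V j" using 2 by (intro vspace_abelian_group)
      show ?case using 2 by (simp add: rep_homD[OF f] minus_add)
    next
      case (3 j c x)
      interpret Module.module K "vspace V j" using 3 by (intro vspace_module)
      show ?case using 3 by (simp add: rep_homD[OF f] smult_r_minus)
    next
      case (4 a x)
      interpret T: abelian_group "vspace V (tail Q a)" using 4 by (intro vspace_abelian_group) simp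
      interpret H: abelian_group "vspace V (head Q a)" using 4 by (intro vspace_abelian_group) simp
      have *: "f (tail Q a) x \<in> carrier (vspace V (tail Q a))"
        using 4 by (simp add: rep_homD[OF f])
      \<comment> \<open>The negative commutes with the arrow by uniqueness of additive inverses at
        the head.\<close>
      have "action V a (\<ominus>\<^bsub>vspace V (tail Q a)\<^esub> f (tail Q a) x)
          \<oplus>\<^bsub>vspace V (head Q a)\<^esub> action V a (f (tail Q a) x) = \<zero>\<^bsub>vspace V (head Q a)\<^esub>"
        using * 4 linear_maps_zero[OF vspace_module vspace_module action_linear, of a]
        by (simp add: linear_mapsD(2)[OF action_linear, symmetric] T.l_neg)
      then show ?case
        using 4 * H.minus_equality
        by (simp add: rep_homD(4)[OF f] linear_mapsD(1)[OF action_linear])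
    qed
    moreover from this f have "g \<oplus>\<^bsub>?A\<^esub> f = \<zero>\<^bsub>?A\<^esub>"
    proof (intro End_ext)
      fix j x assume jx: "j \<in> verts Q" "x \<in> carrier (vspace V j)"
      interpret abelian_group "vspace V j" using jx by (intro vspace_abelian_group)
      show "(g \<oplus>\<^bsub>?A\<^esub> f) j x = \<zero>\<^bsub>?A\<^esub> j x"
        using jx by (simp add: End_algebra_simps rep_homD[OF f] g_def l_neg)
    qed (simp_all add: End_closed zero_rep_hom)
    ultimately show ?case by (auto simp: End_algebra_simps(1))
  qed
  show "monoid ?A"
  proof (rule monoidI, goal_cases)
    case (1 f g)
    then show ?case using End_closed by (simp add: End_algebra_simps(1))
  next
    case 2
    then show ?case using id_rep_hom by (simp add: End_algebra_simps(1))
  next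
    case (3 f g h)
    then have *: "f \<in> rep_hom K Q V V" "g \<in> rep_hom K Q V V" "h \<in> rep_hom K Q V V"
      by (simp_all add: End_algebra_simps(1))
    show ?case
      by (rule End_ext, intro End_closed *, intro End_closed *)
        (use * in \<open>simp add: End_algebra_simps rep_homD(1)\<close>)
  next
    case (4 f)
    then have *: "f \<in> rep_hom K Q V V" by (simp_all add: End_algebra_simps(1))
    show ?case
      by (rule End_ext, intro End_closed id_rep_hom *, rule *)
        (use * in \<open>simp add: End_algebra_simps rep_homD(1)\<close>)
  next
    case (5 f)
    then have *: "f \<in> rep_hom K Q V V" by (simp_all add: End_algebra_simps(1))
    show ?case
      by (rule End_ext, intro End_closed id_rep_hom *, rule *)
        (use * in \<open>simp add: End_algebra_simps rep_homD(1)\<close>)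
  qed
next
  let ?A = "End_algebra K Q V"
  fix f g h assume "f \<in> carrier ?A" "g \<in> carrier ?A" "h \<in> carrier ?A"
  then have *: "f \<in> rep_hom K Q V V" "g \<in> rep_hom K Q V V" "h \<in> rep_hom K Q V V"
    by (simp_all add: End_algebra_simps(1))
  show "(f \<oplus>\<^bsub>?A\<^esub> g) \<otimes>\<^bsub>?A\<^esub> h = f \<otimes>\<^bsub>?A\<^esub> h \<oplus>\<^bsub>?A\<^esub> g \<otimes>\<^bsub>?A\<^esub> h"
    by (rule End_ext, intro End_closed *, intro End_closed *)
      (use * in \<open>simp add: End_algebra_simps rep_homD(1)\<close>)
  show "h \<otimes>\<^bsub>?A\<^esub> (f \<oplus>\<^bsub>?A\<^esub> g) = h \<otimes>\<^bsub>?A\<^esub> f \<oplus>\<^bsub>?A\<^esub> h \<otimes>\<^bsub>?A\<^esub> g"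
    by (rule End_ext, intro End_closed *, intro End_closed *)
      (use * in \<open>simp add: End_algebra_simps rep_homD(1,2)\<close>)
qed

end

section \<open>The radical of the endomorphism algebra\<close>

lemma free_module_simps:
  "carrier (free_module K B) = {f \<in> (\<Pi>\<^sub>E b\<in>B. carrier K). finite {b \<in> B. f b \<noteq> \<zero>\<^bsub>K\<^esub>}}"
  "\<zero>\<^bsub>free_module K B\<^esub> = (\<lambda>b\<in>B. \<zero>\<^bsub>K\<^esub>)"
  "f \<oplus>\<^bsub>free_module K B\<^esub> g = (\<lambda>b\<in>B. f b \<oplus>\<^bsub>K\<^esub> g b)"
  "c \<odot>\<^bsub>free_module K B\<^esub> f = (\<lambda>b\<in>B. c \<otimes>\<^bsub>K\<^esub> f b)"
  by (simp_all add: free_module_def)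

lemma fin_direct_sum_simps:
  "carrier (fin_direct_sum X M) = (\<Pi>\<^sub>E x\<in>X. carrier (M x))"
  "\<zero>\<^bsub>fin_direct_sum X M\<^esub> = (\<lambda>x\<in>X. \<zero>\<^bsub>M x\<^esub>)"
  "f \<oplus>\<^bsub>fin_direct_sum X M\<^esub> g = (\<lambda>x\<in>X. f x \<oplus>\<^bsub>M x\<^esub> g x)"
  "c \<odot>\<^bsub>fin_direct_sum X M\<^esub> f = (\<lambda>x\<in>X. c \<odot>\<^bsub>M x\<^esub> f x)"
  by (simp_all add: fin_direct_sum_def)

lemma (in wf_digraph) paths_Nil: "[] \<in> paths G i j \<longleftrightarrow> i = j \<and> i \<in> verts G"
  by (auto simp: paths_def awalk_Nil_iff)

lemma (in wf_digraph) paths_snoc: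
  "p @ [a] \<in> paths G i k \<longleftrightarrow> a \<in> arcs G \<and> head G a = k \<and> p \<in> paths G i (tail G a)"
  by (auto simp: paths_def awalk_simps)

text \<open>Acyclicity enters the study of the radical only through a bound on path lengths. The
  bound is a parameter and not the number of vertices: the split quiver has one vertex more but no
  longer paths, and reuses the same \<open>b\<close>.\<close>

locale bounded_quiver = K: field K + fin_digraph Q
  for K :: "('k, 'r) ring_scheme" and Q :: "('v, 'e) pre_digraph" +
  fixes d :: "'v \<Rightarrow> nat" and b :: nat
  assumes bounded: "\<And>i j p. p \<in> paths Q i j \<Longrightarrow> length p \<le> b"
begin

section \<open>Coordinates in the fibres of the projective sum\<close>

abbreviation "P \<equiv> proj_sum K Q d"

abbreviation "summands \<equiv> (SIGMA i:verts Q. {..<d i})"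

text \<open>Packs a plain coefficient function into the doubly extensional form that the carriers
  demand, so that all operations can be computed coefficient by coefficient.\<close>

definition vec :: "'v \<Rightarrow> ('v \<Rightarrow> nat \<Rightarrow> 'e list \<Rightarrow> 'k) \<Rightarrow> 'v \<times> nat \<Rightarrow> 'e list \<Rightarrow> 'k" where
  "vec j F = (\<lambda>(i, r)\<in>summands. \<lambda>p\<in>paths Q i j. F i r p)"

lemma vec_apply [simp]:
  "i \<in> verts Q \<Longrightarrow> r < d i \<Longrightarrow> p \<in> paths Q i j \<Longrightarrow> vec j F (i, r) p = F i r p"
  by (simp add: vec_def)

lemma finite_paths: "finite (paths Q i j)"
  by (rule finite_subset[OF _ finite_lists_length_le[OF finite_arcs, of b]])
    (auto simp: paths_def awalk_def intro: bounded[unfolded paths_def])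

text \<open>There are only finitely many paths, so the finite support condition of
  \<open>free_module\<close> is automatic.\<close>

lemma carrier_P:
  "carrier (vspace P j) = (\<Pi>\<^sub>E (i, r)\<in>summands. \<Pi>\<^sub>E p\<in>paths Q i j. carrier K)"
  by (auto simp: proj_sum_def rep_direct_sum_def fin_direct_sum_simps proj_rep_def
      free_module_simps finite_paths intro!: PiE_cong)

lemma P_coeff:
  "x \<in> carrier (vspace P j) \<Longrightarrow> i \<in> verts Q \<Longrightarrow> r < d i \<Longrightarrow> p \<in> paths Q i j \<Longrightarrow>
    x (i, r) p \<in> carrier K"
  by (auto simp: carrier_P dest!: PiE_mem[where x = "(i, r)"])

lemma vec_in_P:
  "(\<And>i r p. i \<in> verts Q \<Longrightarrow> r < d i \<Longrightarrow> p \<in> paths Q i j \<Longrightarrow> F i r p \<in> carrier K) \<Longrightarrow>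
    vec j F \<in> carrier (vspace P j)"
  by (auto simp: carrier_P vec_def)

lemma P_ext:
  assumes "x \<in> carrier (vspace P j)" "y \<in> carrier (vspace P j)"
    and "\<And>i r p. i \<in> verts Q \<Longrightarrow> r < d i \<Longrightarrow> p \<in> paths Q i j \<Longrightarrow> x (i, r) p = y (i, r) p"
  shows "x = y"
proof (rule PiE_ext)
  fix z assume z: "z \<in> summands"
  then obtain i r where ir: "z = (i, r)" "i \<in> verts Q" "r < d i" by auto
  have "x z \<in> (\<Pi>\<^sub>E p\<in>paths Q i j. carrier K)" "y z \<in> (\<Pi>\<^sub>E p\<in>paths Q i j. carrier K)"
    using assms(1,2) z ir(1) by (auto simp: carrier_P dest: PiE_mem)
  then show "x z = y z" using assms(3) ir by (intro PiE_ext) auto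
qed (use assms(1,2) in \<open>simp_all add: carrier_P\<close>)

lemma P_zero: "\<zero>\<^bsub>vspace P j\<^esub> = vec j (\<lambda>_ _ _. \<zero>\<^bsub>K\<^esub>)"
  by (auto simp: proj_sum_def rep_direct_sum_def fin_direct_sum_simps proj_rep_def
      free_module_simps vec_def fun_eq_iff)

lemma P_add: "x \<oplus>\<^bsub>vspace P j\<^esub> y = vec j (\<lambda>i r p. x (i, r) p \<oplus>\<^bsub>K\<^esub> y (i, r) p)"
  by (auto simp: proj_sum_def rep_direct_sum_def fin_direct_sum_simps proj_rep_def
      free_module_simps vec_def fun_eq_iff)

lemma P_smult: "c \<odot>\<^bsub>vspace P j\<^esub> x = vec j (\<lambda>i r p. c \<otimes>\<^bsub>K\<^esub> x (i, r) p)"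
  by (auto simp: proj_sum_def rep_direct_sum_def fin_direct_sum_simps proj_rep_def
      free_module_simps vec_def fun_eq_iff)

lemma P_action_restrict:
  "action P a = (\<lambda>x\<in>carrier (vspace P (tail Q a)). vec (head Q a) (\<lambda>i r p.
    if p \<noteq> [] \<and> last p = a then x (i, r) (butlast p) else \<zero>\<^bsub>K\<^esub>))"
proof -
  have "(\<lambda>z\<in>summands. action (case z of (i, r) \<Rightarrow> proj_rep K Q i) a (x z))
      = vec (head Q a) (\<lambda>i r p. if p \<noteq> [] \<and> last p = a then x (i, r) (butlast p) else \<zero>\<^bsub>K\<^esub>)"
    if x: "x \<in> carrier (vspace P (tail Q a))" for x
    unfolding vec_def
  proof (rule restrict_ext)
    fix z assume z: "z \<in> summands"
    then obtain i r where ir: "z = (i, r)" "i \<in> verts Q" "r < d i" by auto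
    have "x (i, r) \<in> (\<Pi>\<^sub>E p\<in>paths Q i (tail Q a). carrier K)"
      using PiE_mem[OF x[unfolded carrier_P] z] ir(1) by simp
    then show "action (case z of (i, r) \<Rightarrow> proj_rep K Q i) a (x z) =
      (case z of (i, r) \<Rightarrow> \<lambda>p\<in>paths Q i (head Q a).
        if p \<noteq> [] \<and> last p = a then x (i, r) (butlast p) else \<zero>\<^bsub>K\<^esub>)"
      using ir by (simp add: proj_rep_def free_module_simps finite_paths)
  qed
  moreover have "action P a = (\<lambda>x\<in>carrier (vspace P (tail Q a)).
      \<lambda>z\<in>summands. action (case z of (i, r) \<Rightarrow> proj_rep K Q i) a (x z))"
    by (simp add: proj_sum_def rep_direct_sum_def)
  ultimately show ?thesis by (simp cong: restrict_cong)
qed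

lemma P_action:
  "x \<in> carrier (vspace P (tail Q a)) \<Longrightarrow> action P a x = vec (head Q a) (\<lambda>i r p.
    if p \<noteq> [] \<and> last p = a then x (i, r) (butlast p) else \<zero>\<^bsub>K\<^esub>)"
  by (simp add: P_action_restrict)

lemma butlast_paths:
  assumes "p \<in> paths Q i k" "p \<noteq> []"
  shows "last p \<in> arcs Q" "head Q (last p) = k" "butlast p \<in> paths Q i (tail Q (last p))"
  using assms paths_snoc[of "butlast p" "last p" i k] by auto

lemma P_add_coeff:
  "i \<in> verts Q \<Longrightarrow> r < d i \<Longrightarrow> p \<in> paths Q i j \<Longrightarrow>
    (x \<oplus>\<^bsub>vspace P j\<^esub> y) (i, r) p = x (i, r) p \<oplus>\<^bsub>K\<^esub> y (i, r) p"
  by (simp add: P_add)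

lemma P_zero_coeff:
  "i \<in> verts Q \<Longrightarrow> r < d i \<Longrightarrow> p \<in> paths Q i j \<Longrightarrow>
    \<zero>\<^bsub>vspace P j\<^esub> (i, r) p = \<zero>\<^bsub>K\<^esub>"
  by (simp add: P_zero)

lemma P_smult_coeff:
  "i \<in> verts Q \<Longrightarrow> r < d i \<Longrightarrow> p \<in> paths Q i j \<Longrightarrow>
    (c \<odot>\<^bsub>vspace P j\<^esub> x) (i, r) p = c \<otimes>\<^bsub>K\<^esub> x (i, r) p"
  by (simp add: P_smult)

lemma P_action_closed:
  assumes "x \<in> carrier (vspace P (tail Q a))"
  shows "action P a x \<in> carrier (vspace P (head Q a))"
  unfolding P_action[OF assms] using butlast_paths
  by (auto intro!: vec_in_P P_coeff[OF assms])

lemma P_closed: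
  "x \<in> carrier (vspace P j) \<Longrightarrow> y \<in> carrier (vspace P j) \<Longrightarrow>
    x \<oplus>\<^bsub>vspace P j\<^esub> y \<in> carrier (vspace P j)"
  "\<zero>\<^bsub>vspace P j\<^esub> \<in> carrier (vspace P j)"
  "c \<in> carrier K \<Longrightarrow> x \<in> carrier (vspace P j) \<Longrightarrow>
    c \<odot>\<^bsub>vspace P j\<^esub> x \<in> carrier (vspace P j)"
  unfolding P_add P_zero P_smult by (rule vec_in_P; simp add: P_coeff)+

section \<open>The projective sum is a representation\<close>

lemma P_module: "Module.module K (vspace P j)"
proof (rule moduleI)
  show "abelian_group (vspace P j)"
  proof (rule abelian_groupI, goal_cases)
    case (3 x y z)
    then show ?case
      by (intro P_ext[of _ j]) (simp_all add: P_closed P_add_coeff P_coeff K.a_assoc)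
  next
    case (4 x y)
    then show ?case
      by (intro P_ext[of _ j]) (simp_all add: P_closed P_add_coeff P_coeff K.a_comm)
  next
    case (5 x)
    then show ?case
      by (intro P_ext[of _ j]) (simp_all add: P_closed P_add_coeff P_zero_coeff P_coeff)
  next
    case (6 x)
    define y where "y = vec j (\<lambda>i r p. \<ominus>\<^bsub>K\<^esub> x (i, r) p)"
    have y: "y \<in> carrier (vspace P j)"
      unfolding y_def using 6 by (auto intro!: vec_in_P K.a_inv_closed P_coeff)
    have "y \<oplus>\<^bsub>vspace P j\<^esub> x = \<zero>\<^bsub>vspace P j\<^esub>"
      using 6 y
      by (intro P_ext[of _ j]) (simp_all add: P_closed P_add_coeff P_zero_coeff P_coeff y_def K.l_neg)
    with y show ?case by blast
  qed (simp_all add: P_closed)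
next
  fix c e x assume "c \<in> carrier K" "e \<in> carrier K" and "x \<in> carrier (vspace P j)"
  then show "(c \<oplus>\<^bsub>K\<^esub> e) \<odot>\<^bsub>vspace P j\<^esub> x =
      c \<odot>\<^bsub>vspace P j\<^esub> x \<oplus>\<^bsub>vspace P j\<^esub> e \<odot>\<^bsub>vspace P j\<^esub> x"
    and "(c \<otimes>\<^bsub>K\<^esub> e) \<odot>\<^bsub>vspace P j\<^esub> x = c \<odot>\<^bsub>vspace P j\<^esub> (e \<odot>\<^bsub>vspace P j\<^esub> x)"
    by (intro P_ext[of _ j];
        simp add: P_closed P_add_coeff P_smult_coeff P_coeff K.l_distr K.m_assoc)+
next
  fix c x y
  assume "c \<in> carrier K" "x \<in> carrier (vspace P j)" "y \<in> carrier (vspace P j)"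
  then show "c \<odot>\<^bsub>vspace P j\<^esub> (x \<oplus>\<^bsub>vspace P j\<^esub> y) =
      c \<odot>\<^bsub>vspace P j\<^esub> x \<oplus>\<^bsub>vspace P j\<^esub> c \<odot>\<^bsub>vspace P j\<^esub> y"
    by (intro P_ext[of _ j])
      (simp_all add: P_closed P_add_coeff P_smult_coeff P_coeff K.r_distr)
next
  fix x assume "x \<in> carrier (vspace P j)"
  then show "\<one>\<^bsub>K\<^esub> \<odot>\<^bsub>vspace P j\<^esub> x = x"
    by (intro P_ext[of _ j]) (simp_all add: P_closed P_smult_coeff P_coeff)
qed (simp_all add: P_closed K.is_cring)

lemma is_quiver_rep_P: "is_quiver_rep K Q P"
proof -
  have "action P a \<in> linear_maps K (vspace P (tail Q a)) (vspace P (head Q a))"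
    if "a \<in> arcs Q" for a
    unfolding linear_maps_def
  proof (intro CollectI conjI ballI PiE_I)
    fix x y assume x: "x \<in> carrier (vspace P (tail Q a))" and y: "y \<in> carrier (vspace P (tail Q a))"
    show "action P a (x \<oplus>\<^bsub>vspace P (tail Q a)\<^esub> y)
        = action P a x \<oplus>\<^bsub>vspace P (head Q a)\<^esub> action P a y"
      by (rule P_ext[OF P_action_closed[OF P_closed(1)[OF x y]]
            P_closed(1)[OF P_action_closed[OF x] P_action_closed[OF y]]])
        (auto simp: P_closed x y P_action P_add_coeff dest: butlast_paths(3))
  next
    fix c x assume x: "x \<in> carrier (vspace P (tail Q a))" and c: "c \<in> carrier K"
    show "action P a (c \<odot>\<^bsub>vspace P (tail Q a)\<^esub> x) = c \<odot>\<^bsub>vspace P (head Q a)\<^esub> action P a x"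
      by (rule P_ext[OF P_action_closed[OF P_closed(3)[OF c x]]
            P_closed(3)[OF c P_action_closed[OF x]]])
        (auto simp: P_closed x c P_action P_smult_coeff dest: butlast_paths(3))
  qed (erule P_action_closed, simp add: P_action_restrict)
  then show ?thesis by (simp add: is_quiver_rep_def P_module)
qed

sublocale quiver_representation K Q P
  by unfold_locales (rule is_quiver_rep_P)

text \<open>The vectors at \<open>j\<close> lying in the \<open>n\<close>-th power of the arrow ideal.\<close>

definition layer :: "nat \<Rightarrow> 'v \<Rightarrow> ('v \<times> nat \<Rightarrow> 'e list \<Rightarrow> 'k) set" where
  "layer n j = {x \<in> carrier (vspace P j).
    \<forall>i\<in>verts Q. \<forall>r<d i. \<forall>p\<in>paths Q i j. length p < n \<longrightarrow> x (i, r) p = \<zero>\<^bsub>K\<^esub>}"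

section \<open>The filtration of the fibres by path length\<close>

lemma layer_carrier: "x \<in> layer n j \<Longrightarrow> x \<in> carrier (vspace P j)"
  by (simp add: layer_def)

lemma layer_0: "layer 0 j = carrier (vspace P j)"
  by (simp add: layer_def)

lemma layer_zero: "\<zero>\<^bsub>vspace P j\<^esub> \<in> layer n j"
  by (simp add: layer_def P_closed) (simp add: P_zero)

lemma layer_add:
  "x \<in> layer n j \<Longrightarrow> y \<in> layer n j \<Longrightarrow> x \<oplus>\<^bsub>vspace P j\<^esub> y \<in> layer n j"
  by (simp add: layer_def P_closed P_add_coeff)

lemma layer_action:
  assumes x: "x \<in> layer n (tail Q a)"
  shows "action P a x \<in> layer (Suc n) (head Q a)"
proof -
  have "action P a x (i, r) p = \<zero>\<^bsub>K\<^esub>"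
    if "i \<in> verts Q" "r < d i" "p \<in> paths Q i (head Q a)" "length p < Suc n" for i r p
  proof (cases "p \<noteq> [] \<and> last p = a")
    case True
    then have "length (butlast p) < n" using that(4) by (cases p) auto
    then show ?thesis
      using that x butlast_paths(3)[OF that(3)] True by (simp add: layer_def P_action)
  next
    case False
    then show ?thesis using that x by (auto simp: layer_def P_action)
  qed
  then show ?thesis
    using x by (simp add: layer_def P_action_closed)
qed

lemma layer_eq_zero:
  assumes "x \<in> layer n j" "b < n"
  shows "x = \<zero>\<^bsub>vspace P j\<^esub>"
proof (rule P_ext)
  fix i r p assume "i \<in> verts Q" "r < d i" "p \<in> paths Q i j"
  then show "x (i, r) p = \<zero>\<^bsub>vspace P j\<^esub> (i, r) p"
    using assms bounded[of p i j] by (auto simp: layer_def P_zero)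
qed (use assms in \<open>auto simp: layer_def P_closed\<close>)

text \<open>The only path of length below one is \<open>[]\<close>, and it ends at \<open>j\<close>
  only if it starts there.\<close>

lemma layer_1_iff:
  assumes "j \<in> verts Q"
  shows "x \<in> layer (Suc 0) j \<longleftrightarrow>
    x \<in> carrier (vspace P j) \<and> (\<forall>r<d j. x (j, r) [] = \<zero>\<^bsub>K\<^esub>)"
  using assms by (auto simp: layer_def paths_Nil)

text \<open>Vectors without constant paths are sums of images of arrows, as every path has a last arrow.\<close>

lemma layer_Suc_induct [consumes 1, case_names zero add action]:
  assumes x: "x \<in> layer (Suc n) k"
    and zero: "C \<zero>\<^bsub>vspace P k\<^esub>"
    and add: "\<And>y z. y \<in> layer (Suc n) k \<Longrightarrow> z \<in> layer (Suc n) k \<Longrightarrow> C y \<Longrightarrow> C z \<Longrightarrow>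
      C (y \<oplus>\<^bsub>vspace P k\<^esub> z)"
    and action: "\<And>a y. a \<in> arcs Q \<Longrightarrow> head Q a = k \<Longrightarrow> y \<in> layer n (tail Q a) \<Longrightarrow> C (action P a y)"
  shows "C x"
proof -
  \<comment> \<open>Induction on a set \<open>S\<close> of arrows containing every last arrow of a
    path in the support of \<open>x\<close>; one arrow is split off at a time.\<close>
  have "C x" if "finite S" "S \<subseteq> arcs Q" "x \<in> layer (Suc n) k"
    "\<And>i r p. i \<in> verts Q \<Longrightarrow> r < d i \<Longrightarrow> p \<in> paths Q i k \<Longrightarrow> p \<noteq> [] \<Longrightarrow> last p \<notin> S \<Longrightarrow>
      x (i, r) p = \<zero>\<^bsub>K\<^esub>" for S x
    using that
  proof (induction S arbitrary: x rule: finite_induct)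
    case empty
    have "x = \<zero>\<^bsub>vspace P k\<^esub>"
    proof (rule P_ext)
      fix i r p assume "i \<in> verts Q" "r < d i" "p \<in> paths Q i k"
      then show "x (i, r) p = \<zero>\<^bsub>vspace P k\<^esub> (i, r) p"
        using empty.prems by (cases "p = []") (auto simp: layer_def P_zero)
    qed (use empty.prems in \<open>auto simp: layer_def P_closed\<close>)
    then show ?case using zero by simp
  next
    case (insert a S)
    show ?case
    proof (cases "head Q a = k")
      case False
      show ?thesis
      proof (rule insert.IH)
        fix i r p assume "i \<in> verts Q" "r < d i" "p \<in> paths Q i k" "p \<noteq> []" "last p \<notin> S"
        then show "x (i, r) p = \<zero>\<^bsub>K\<^esub>"
          using insert.prems(3) butlast_paths(2)[of p i k] False by (metis insertE)
      qed (use insert.prems in auto)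
    next
      case True
      have a: "a \<in> arcs Q" using insert.prems by simp
      have xc: "x \<in> carrier (vspace P k)" using insert.prems(2) by (rule layer_carrier)
      \<comment> \<open>The paths ending in \<open>a\<close> are collected, with \<open>a\<close>
        removed, in \<open>y\<close>; the others stay in \<open>z\<close>. Removing \<open>a\<close>
        shortens a path by one, so \<open>y\<close> lies one layer lower.\<close>
      define y where "y = vec (tail Q a) (\<lambda>i r p. x (i, r) (p @ [a]))"
      define z where "z = vec k (\<lambda>i r p. if p \<noteq> [] \<and> last p = a then \<zero>\<^bsub>K\<^esub> else x (i, r) p)"
      have yc: "y \<in> carrier (vspace P (tail Q a))"
        unfolding y_def using a True by (intro vec_in_P P_coeff[OF xc]) (simp_all add: paths_snoc)
      then have y: "y \<in> layer n (tail Q a)"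
        using insert.prems(2) a True by (auto simp: layer_def y_def paths_snoc)
      have zc: "z \<in> carrier (vspace P k)"
        unfolding z_def by (auto intro!: vec_in_P P_coeff[OF xc])
      then have z: "z \<in> layer (Suc n) k"
        using insert.prems(2) by (auto simp: layer_def z_def)
      have "x = z \<oplus>\<^bsub>vspace P k\<^esub> action P a y"
      proof (rule P_ext)
        show "z \<oplus>\<^bsub>vspace P k\<^esub> action P a y \<in> carrier (vspace P k)"
          using zc P_action_closed[OF yc] True by (simp add: P_closed)
        fix i r p assume p: "i \<in> verts Q" "r < d i" "p \<in> paths Q i k"
        then show "x (i, r) p = (z \<oplus>\<^bsub>vspace P k\<^esub> action P a y) (i, r) p"
          using True P_coeff[OF xc p] butlast_paths(3)[OF p(3)]
          by (auto simp: P_add_coeff z_def P_action[OF yc]) (auto simp: y_def)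
      qed (rule xc)
      moreover have "C z"
      proof (rule insert.IH)
        fix i r p assume "i \<in> verts Q" "r < d i" "p \<in> paths Q i k" "p \<noteq> []" "last p \<notin> S"
        then show "z (i, r) p = \<zero>\<^bsub>K\<^esub>"
          using insert.prems(3) by (auto simp: z_def)
      qed (use insert.prems z in auto)
      moreover have "C (action P a y)" using action a True y by blast
      ultimately show ?thesis
        using add z layer_action[OF y] True by simp
    qed
  qed
  from this[OF finite_arcs] show ?thesis
    using x butlast_paths(1) by blast
qed

text \<open>A vector of layer \<open>Suc m\<close> is a sum of images of arrows on layer
  \<open>m\<close>. Since \<open>f\<close> commutes with arrows and arrows raise the layer by one,
  any estimate for layer \<open>m\<close> propagates to the next layer.\<close>

lemma rep_hom_layer_Suc:
  assumes f: "f \<in> rep_hom K Q P P"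
    and shift: "\<And>k x. k \<in> verts Q \<Longrightarrow> x \<in> layer m k \<Longrightarrow> f k x \<in> layer n k"
    and k: "k \<in> verts Q" and x: "x \<in> layer (Suc m) k"
  shows "f k x \<in> layer (Suc n) k"
  using x
proof (induction rule: layer_Suc_induct)
  case zero
  show ?case
    using linear_maps_zero[OF P_module P_module rep_homD(5)[OF f k]] layer_zero by simp
next
  case (add y z)
  then show ?case
    using rep_homD(2)[OF f k] layer_add layer_carrier by metis
next
  case (action a y)
  then show ?case
    using rep_homD(4)[OF f, of a y] layer_action shift layer_carrier tail_in_verts by metis
qed

text \<open>This is the space of homomorphisms from \<open>P\<close> to its radical
  subrepresentation, the span of the paths of positive length.\<close>

definition radical_maps where
  "radical_maps = {f \<in> rep_hom K Q P P.
    \<forall>j\<in>verts Q. \<forall>x\<in>carrier (vspace P j). f j x \<in> layer (Suc 0) j}"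

section \<open>Nilpotence of the radical maps\<close>

lemma rep_hom_layer_1:
  "f \<in> rep_hom K Q P P \<Longrightarrow> k \<in> verts Q \<Longrightarrow> x \<in> layer (Suc 0) k \<Longrightarrow> f k x \<in> layer (Suc 0) k"
  by (rule rep_hom_layer_Suc[where m = 0]) (auto simp: layer_0 rep_homD(1))

text \<open>The case \<open>n = 0\<close> is the definition; \<open>rep_hom_layer_Suc\<close>
  carries the gain of one layer upwards.\<close>

lemma radical_maps_layer:
  assumes f: "f \<in> radical_maps" and "k \<in> verts Q" "x \<in> layer n k"
  shows "f k x \<in> layer (Suc n) k"
  using assms(2,3)
proof (induction n arbitrary: k x)
  case 0
  then show ?case using f by (simp add: radical_maps_def layer_0)
next
  case (Suc n)
  from f have "f \<in> rep_hom K Q P P" by (simp add: radical_maps_def)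
  then show ?case using rep_hom_layer_Suc Suc by blast
qed

lemma radical_maps_mult:
  assumes "f \<in> rep_hom K Q P P" "g \<in> radical_maps"
  shows "f \<otimes>\<^bsub>End_algebra K Q P\<^esub> g \<in> radical_maps"
  using assms End_closed(2)[of f g] rep_hom_layer_1[of f]
  by (simp add: radical_maps_def) (simp add: End_algebra_simps)

lemma radical_maps_nilpotent:
  assumes f: "f \<in> radical_maps"
  shows "f [^]\<^bsub>End_algebra K Q P\<^esub> Suc b = \<zero>\<^bsub>End_algebra K Q P\<^esub>"
proof -
  interpret A: ring "End_algebra K Q P" by (rule ring_End_algebra)
  have fc: "f \<in> carrier (End_algebra K Q P)"
    using f by (simp add: radical_maps_def End_algebra_simps(1))
  \<comment> \<open>Powers grow by a factor on the right, so \<open>f\<close> hits \<open>x\<close>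
    first and moves it to layer \<open>Suc m\<close>; hence \<open>m\<close> has to vary in the
    induction. With \<open>m = 0\<close>, \<open>Suc b\<close> factors exceed the length of every
    path.\<close>
  have *: "(f [^]\<^bsub>End_algebra K Q P\<^esub> n) k x \<in> layer (m + n) k"
    if "k \<in> verts Q" "x \<in> layer m k" for n m k x
    using that
  proof (induction n arbitrary: m x)
    case 0
    then show ?case
      using layer_carrier[of x] by (simp add: End_algebra_simps)
  next
    case (Suc n)
    then show ?case
      using Suc.IH[OF _ radical_maps_layer[OF f]] layer_carrier[of x]
      by (simp add: End_algebra_simps)
  qed
  show ?thesis
  proof (rule End_ext)
    fix k x assume kx: "k \<in> verts Q" "x \<in> carrier (vspace P k)"
    then show "(f [^]\<^bsub>End_algebra K Q P\<^esub> Suc b) k x = \<zero>\<^bsub>End_algebra K Q P\<^esub> k x"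
      using layer_eq_zero[OF *[OF kx(1), of x 0 "Suc b"]]
      by (simp add: layer_0 End_algebra_simps)
  qed (use fc A.nat_pow_closed[OF fc] zero_rep_hom in \<open>simp_all add: End_algebra_simps(1) End_closed(2) del: A.nat_pow_Suc\<close>)
qed

text \<open>The image of the generators of one copy of \<open>P\<^sub>Q(k)\<close> can be prescribed by arbitrary
  coefficients \<open>c\<close> at the constant paths; all other generators are sent to \<open>0\<close>.\<close>

definition column_map ::
  "'v \<Rightarrow> nat \<Rightarrow> (nat \<Rightarrow> 'k) \<Rightarrow> 'v \<Rightarrow> ('v \<times> nat \<Rightarrow> 'e list \<Rightarrow> 'k) \<Rightarrow> 'v \<times> nat \<Rightarrow> 'e list \<Rightarrow> 'k" where
  "column_map k s c = (\<lambda>j\<in>verts Q. \<lambda>x\<in>carrier (vspace P j).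
    vec j (\<lambda>i t p. if i = k then c t \<otimes>\<^bsub>K\<^esub> x (k, s) p else \<zero>\<^bsub>K\<^esub>))"

text \<open>The map mixes the copies of P_Q(k) by scalars and leaves the paths alone, so it commutes
  with the arrows, which act on paths only.\<close>

lemma column_map_rep_hom:
  assumes k: "k \<in> verts Q" and s: "s < d k" and c: "\<And>t. t < d k \<Longrightarrow> c t \<in> carrier K"
  shows "column_map k s c \<in> rep_hom K Q P P"
proof -
  let ?F = "\<lambda>j x. vec j (\<lambda>i t p. if i = k then c t \<otimes>\<^bsub>K\<^esub> x (k, s) p else \<zero>\<^bsub>K\<^esub>)"
  have cl: "?F j x \<in> carrier (vspace P j)" if "x \<in> carrier (vspace P j)" for j x
    using that k s c by (intro vec_in_P) (auto simp: P_coeff)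
  show ?thesis
    unfolding column_map_def
  proof (rule rep_homI, goal_cases)
    case (2 j x y)
    then show ?case
      using k s by (intro conjI P_ext[of _ j]) (auto simp: P_closed cl P_add_coeff K.r_distr c P_coeff)
  next
    case (3 j a x)
    then show ?case
      using k s by (intro conjI P_ext[of _ j]) (auto simp: P_closed cl P_smult_coeff K.m_lcomm c P_coeff)
  next
    case (4 a x)
    have "?F (head Q a) (action P a x) = action P a (?F (tail Q a) x)"
    proof (rule P_ext[OF cl[OF P_action_closed] P_action_closed[OF cl]])
      fix i t p assume "i \<in> verts Q" "t < d i" "p \<in> paths Q i (head Q a)"
      then show "?F (head Q a) (action P a x) (i, t) p = action P a (?F (tail Q a) x) (i, t) p"
        using 4 k s butlast_paths(3)[of p i "head Q a"] by (auto simp: cl P_action c P_coeff)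
    qed (use 4 in simp_all)
    then show ?case using 4 by (simp add: P_action_closed)
  qed (rule cl)
qed

theorem jacobson_radical_A_alg: "jacobson_radical (A_alg K Q d) = radical_maps"
proof -
  let ?A = "End_algebra K Q P"
  interpret A: ring ?A by (rule ring_End_algebra)
  have "radical_maps \<subseteq> jacobson_radical ?A"
  proof (rule A.nil_left_ideal_subset_jacobson_radical)
    show "\<exists>n::nat. f [^]\<^bsub>?A\<^esub> n = \<zero>\<^bsub>?A\<^esub>" if "f \<in> radical_maps" for f
      using radical_maps_nilpotent[OF that] by blast
  qed (use radical_maps_mult in \<open>auto simp: End_algebra_simps(1) radical_maps_def\<close>)
  moreover have "f \<in> radical_maps" if f: "f \<in> jacobson_radical ?A" for f
  proof (rule ccontr)
    assume "f \<notin> radical_maps"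
    moreover have fc: "f \<in> rep_hom K Q P P"
      using f by (simp add: jacobson_radical_def End_algebra_simps(1))
    ultimately obtain k x where k: "k \<in> verts Q" and x: "x \<in> carrier (vspace P k)"
      and fx: "f k x \<notin> layer (Suc 0) k"
      unfolding radical_maps_def by blast
    \<comment> \<open>The kernel of evaluation at \<open>x\<close> modulo
      \<open>layer (Suc 0) k\<close>. It is maximal because the quotient of the fibre, spanned by
      the constant paths at \<open>k\<close>, is simple: column maps carry any nonzero vector of it
      to any other.\<close>
    define M where "M = {g \<in> rep_hom K Q P P. g k x \<in> layer (Suc 0) k}"
    have "left_ideal M ?A"
    proof (rule left_idealI)
      have "\<zero>\<^bsub>?A\<^esub> \<in> M"
        using zero_rep_hom k x layer_zero by (simp add: M_def End_algebra_simps)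
      then show "M \<noteq> {}" by blast
    next
      fix g h assume "g \<in> M" "h \<in> M"
      then show "g \<oplus>\<^bsub>?A\<^esub> h \<in> M"
        using k x End_closed(1) layer_add by (simp add: M_def) (simp add: End_algebra_simps)
    next
      fix g h assume "g \<in> carrier ?A" "h \<in> M"
      then show "g \<otimes>\<^bsub>?A\<^esub> h \<in> M"
        using k x End_closed(2) rep_hom_layer_1 by (simp add: M_def End_algebra_simps)
    qed (auto simp: A.ring_axioms M_def End_algebra_simps(1))
    moreover have "M \<noteq> carrier ?A"
      using fc fx by (auto simp: M_def End_algebra_simps(1))
    moreover have "J = carrier ?A" if J: "left_ideal J ?A" "M \<subseteq> J" "J \<noteq> M" for J
    proof (rule A.left_ideal_one[OF J(1)])
      note J_closed = A.left_idealD[OF J(1)]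
      obtain y where y: "y \<in> J" "y \<notin> M" using J by blast
      then have yc: "y \<in> rep_hom K Q P P" using J_closed(1) by (auto simp: End_algebra_simps(1))
      then have yx: "y k x \<in> carrier (vspace P k)" using k x by (simp add: rep_homD(1))
      obtain s where s: "s < d k" "y k x (k, s) [] \<noteq> \<zero>\<^bsub>K\<^esub>"
        using y(2) yc yx k by (auto simp: M_def layer_1_iff)
      define w where "w = y k x (k, s) []"
      have nil: "[] \<in> paths Q k k" using k by (simp add: paths_Nil)
      have w: "w \<in> carrier K" "w \<noteq> \<zero>\<^bsub>K\<^esub>"
        using s P_coeff[OF yx k s(1) nil] by (simp_all add: w_def)
      \<comment> \<open>Chosen so that the column map sends \<open>y k x\<close>, whose coefficient
        at copy \<open>s\<close> is \<open>w\<close>, to the negative of \<open>x\<close> modulo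
        \<open>layer (Suc 0) k\<close>. Then \<open>\<one> \<oplus> z\<close> kills \<open>x\<close>
        modulo that layer.\<close>
      define c where "c t = \<ominus>\<^bsub>K\<^esub> (x (k, t) [] \<otimes>\<^bsub>K\<^esub> inv\<^bsub>K\<^esub> w)" for t
      have xt: "x (k, t) [] \<in> carrier K" if "t < d k" for t
        using P_coeff[OF x k that nil] .
      have iw: "inv\<^bsub>K\<^esub> w \<in> carrier K" "inv\<^bsub>K\<^esub> w \<otimes>\<^bsub>K\<^esub> w = \<one>\<^bsub>K\<^esub>"
        using w K.field_Units by auto
      have h: "column_map k s c \<in> rep_hom K Q P P"
        using k s(1) xt iw by (intro column_map_rep_hom) (auto simp: c_def)
      define z where "z = column_map k s c \<otimes>\<^bsub>?A\<^esub> y"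
      have zJ: "z \<in> J"
        using h y(1) J_closed(4) by (simp add: z_def End_algebra_simps(1))
      then have zc: "z \<in> carrier ?A" using J_closed(1) by blast
      have "\<one>\<^bsub>?A\<^esub> \<oplus>\<^bsub>?A\<^esub> z \<in> M"
      proof -
        have "((\<one>\<^bsub>?A\<^esub> \<oplus>\<^bsub>?A\<^esub> z) k x) (k, t) [] = \<zero>\<^bsub>K\<^esub>" if t: "t < d k" for t
        proof -
          have "z k x = column_map k s c k (y k x)"
            using k x by (simp add: z_def End_algebra_simps)
          then have "(z k x) (k, t) [] = c t \<otimes>\<^bsub>K\<^esub> w"
            using k yx t nil by (simp add: column_map_def w_def)
          moreover have "((\<one>\<^bsub>?A\<^esub> \<oplus>\<^bsub>?A\<^esub> z) k x) = x \<oplus>\<^bsub>vspace P k\<^esub> z k x"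
            using k x by (simp add: End_algebra_simps)
          ultimately show ?thesis
            using k t nil xt[OF t] iw w by (simp add: P_add_coeff c_def K.l_minus K.m_assoc K.r_neg)
        qed
        moreover have oz: "\<one>\<^bsub>?A\<^esub> \<oplus>\<^bsub>?A\<^esub> z \<in> rep_hom K Q P P"
          using A.a_closed[OF A.one_closed zc] by (simp only: End_algebra_simps(1))
        moreover have "(\<one>\<^bsub>?A\<^esub> \<oplus>\<^bsub>?A\<^esub> z) k x \<in> carrier (vspace P k)"
          using oz k x by (rule rep_homD(1))
        ultimately show ?thesis
          unfolding M_def layer_1_iff[OF k] by blast
      qed
      \<comment> \<open>Both \<open>\<one> \<oplus> z\<close>, which lies in \<open>M\<close>, and
        \<open>z\<close> belong to \<open>J\<close>; their difference is the unit.\<close>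
      then have "(\<one>\<^bsub>?A\<^esub> \<oplus>\<^bsub>?A\<^esub> z) \<oplus>\<^bsub>?A\<^esub> (\<ominus>\<^bsub>?A\<^esub> \<one>\<^bsub>?A\<^esub>) \<otimes>\<^bsub>?A\<^esub> z \<in> J"
        using J(2) by (intro J_closed(3)[OF _ J_closed(4)[OF A.a_inv_closed[OF A.one_closed] zJ]]) (rule subsetD)
      then show "\<one>\<^bsub>?A\<^esub> \<in> J"
        by (simp add: A.l_minus[OF A.one_closed zc] A.a_assoc zc A.r_neg)
    qed
    ultimately have "maximal_left_ideal M ?A"
      unfolding maximal_left_ideal_def by blast
    then have "f \<in> M" using f by (simp add: jacobson_radical_def)
    then show False using fx by (simp add: M_def)
  qed
  ultimately show ?thesis unfolding A_alg_def by blast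
qed

end

section \<open>Lifting paths along the splitting\<close>

lemma (in bounded_quiver) layer_1_source:
  assumes "in_arcs Q j = {}" "x \<in> layer (Suc 0) j"
  shows "x = \<zero>\<^bsub>vspace P j\<^esub>"
proof (rule P_ext)
  fix i r p assume ir: "i \<in> verts Q" "r < d i" and p: "p \<in> paths Q i j"
  have "p = []"
    using butlast_paths(1,2)[OF p] assms(1) by (auto simp: in_arcs_def)
  then show "x (i, r) p = \<zero>\<^bsub>vspace P j\<^esub> (i, r) p"
    using ir p assms(2) by (simp add: layer_def P_zero_coeff)
qed (use assms in \<open>auto simp: layer_carrier P_closed\<close>)

lemma (in wf_digraph) paths_Cons:
  "a # p \<in> paths G i k \<longleftrightarrow> a \<in> arcs G \<and> i = tail G a \<and> p \<in> paths G (head G a) k"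
  by (simp add: paths_def awalk_Cons_iff)

text \<open>A walk that repeats a vertex contains a closed walk, hence a cycle. So the vertices of
  \<open>p\<close>, one more than its arrows, are distinct.\<close>

lemma (in fin_digraph) acyclic_path_length:
  assumes "\<nexists>c. cycle c" and p: "p \<in> paths G i j"
  shows "length p \<le> card (verts G)"
proof -
  have p: "awalk i p j" using p by (simp add: paths_def)
  have "distinct (awalk_verts i p)"
  proof (rule ccontr)
    assume "\<not> distinct (awalk_verts i p)"
    with p obtain q where "closed_w q" by (rule awalk_cyc_decompE')
    then show False using closed_w_imp_cycle assms(1) by blast
  qed
  moreover have "set (awalk_verts i p) \<subseteq> verts G"
    using iffD1[OF awalk_conv p] by blast
  ultimately have "length (awalk_verts i p) \<le> card (verts G)"
    by (metis card_mono distinct_card finite_verts)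
  then show ?thesis by (simp add: length_awalk_verts)
qed

fun orig_vertex :: "'v \<Rightarrow> 'v split_vertex \<Rightarrow> 'v" where
  "orig_vertex v (Old i) = i"
| "orig_vertex v SplitA = v"
| "orig_vertex v SplitB = v"

fun orig_arrow :: "'e split_arrow \<Rightarrow> 'e" where
  "orig_arrow (Kept a) = a"
| "orig_arrow (Bar a) = a"

locale vertex_split = bounded_quiver K Q d b
  for K :: "('k, 'r) ring_scheme" and Q :: "('v, 'e) pre_digraph" and d b +
  fixes v :: 'v and A B :: "'e set"
  assumes v: "v \<in> verts Q" and source: "in_arcs Q v = {}"
    and blocks: "A \<union> B = out_arcs Q v" "A \<inter> B = {}"
begin

abbreviation "R \<equiv> split_quiver Q v A B"

abbreviation "ov \<equiv> orig_vertex v"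

definition lift_arrow :: "'e \<Rightarrow> 'e split_arrow" where
  "lift_arrow a = (if a \<in> A \<union> B then Bar a else Kept a)"

text \<open>The start of the lift of \<open>p\<close> that ends at \<open>w\<close>. The first arrow
  decides between the copies of \<open>v\<close>; a constant path has none, and there the prescribed
  end \<open>w\<close> decides.\<close>

definition lift_source :: "'v split_vertex \<Rightarrow> 'e list \<Rightarrow> 'v split_vertex" where
  "lift_source w p = (if p = [] then w else tail R (lift_arrow (hd p)))"

lemma head_ne_v: "a \<in> arcs Q \<Longrightarrow> head Q a \<noteq> v"
  using source by (auto simp: in_arcs_def)

lemma blocks_tail: "a \<in> A \<Longrightarrow> a \<in> arcs Q \<and> tail Q a = v" "a \<in> B \<Longrightarrow> a \<in> arcs Q \<and> tail Q a = v"
  using blocks(1) by (auto simp: out_arcs_def)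

text \<open>The type contains the value \<open>Old v\<close>, which is no vertex of \<open>R\<close>
  and has to be excluded.\<close>

lemma split_verts: "w \<in> verts R \<longleftrightarrow> ov w \<in> verts Q \<and> w \<noteq> Old v"
  using v by (cases w) (auto simp: split_quiver_def)

lemma old_vertex: "w \<in> verts R \<Longrightarrow> ov w \<noteq> v \<Longrightarrow> w = Old (ov w)"
  by (cases w) auto

lemma split_arcs:
  assumes "e \<in> arcs R"
  shows "orig_arrow e \<in> arcs Q" "tail R e \<in> verts R" "ov (tail R e) = tail Q (orig_arrow e)"
    "head R e = Old (head Q (orig_arrow e))" "lift_arrow (orig_arrow e) = e"
proof -
  have "tail Q a = v \<longleftrightarrow> a \<in> A \<or> a \<in> B" if "a \<in> arcs Q" for a
    using that blocks(1) by (auto simp: out_arcs_def)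
  then show "orig_arrow e \<in> arcs Q" "tail R e \<in> verts R" "ov (tail R e) = tail Q (orig_arrow e)"
    "head R e = Old (head Q (orig_arrow e))" "lift_arrow (orig_arrow e) = e"
    using assms blocks_tail by (auto simp: split_quiver_def lift_arrow_def image_iff)
qed

lemma ov_head: "e \<in> arcs R \<Longrightarrow> ov (head R e) = head Q (orig_arrow e)"
  by (simp add: split_arcs)

lemma lift_arrow_arcs: "a \<in> arcs Q \<Longrightarrow> lift_arrow a \<in> arcs R"
  by (auto simp: split_quiver_def lift_arrow_def)

lemma orig_lift_arrow [simp]: "orig_arrow (lift_arrow a) = a"
  by (simp add: lift_arrow_def)

lemma head_lift_arrow: "a \<in> arcs Q \<Longrightarrow> head R (lift_arrow a) = Old (head Q a)"
  using split_arcs(4)[OF lift_arrow_arcs] by simp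

lemma wf_split: "wf_digraph R"
proof
  fix e assume e: "e \<in> arcs R"
  show "tail R e \<in> verts R" using e by (rule split_arcs(2))
  show "head R e \<in> verts R"
    using split_arcs(1)[OF e] head_ne_v by (auto simp: split_arcs(4)[OF e] split_verts)
qed

text \<open>Forgetting the bars loses nothing once the end \<open>w\<close> is known: every arrow is
  recovered by \<open>lift_arrow\<close>, the start by \<open>lift_source\<close>. Together with
  \<open>lift_path\<close> this is the bijection between paths of \<open>R\<close> ending at
  \<open>w\<close> and paths of \<open>Q\<close> ending at \<open>ov w\<close>.\<close>

lemma orig_path:
  "p \<in> paths R u w \<Longrightarrow>
    map orig_arrow p \<in> paths Q (ov u) (ov w) \<and> lift_source w (map orig_arrow p) = u \<and>
    map lift_arrow (map orig_arrow p) = p"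
proof (induction p arbitrary: u)
  case Nil
  then show ?case
    using split_verts by (auto simp: wf_digraph.paths_Nil[OF wf_split] paths_Nil lift_source_def)
next
  case (Cons e p)
  then have e: "e \<in> arcs R" and u: "u = tail R e"
    and "p \<in> paths R (head R e) w"
    by (simp_all add: wf_digraph.paths_Cons[OF wf_split])
  then have p: "p \<in> paths R (Old (head Q (orig_arrow e))) w" by (simp add: split_arcs(4))
  show ?case
    using Cons.IH[OF p] by (simp add: paths_Cons split_arcs[OF e] u lift_source_def)
qed

lemma lift_source_verts:
  "p \<in> paths Q i (ov w) \<Longrightarrow> w \<in> verts R \<Longrightarrow> lift_source w p \<in> verts R \<and> ov (lift_source w p) = i"
  by (cases p) (auto simp: paths_Nil paths_Cons lift_source_def split_arcs lift_arrow_arcs)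

lemma lift_path:
  "p \<in> paths Q i (ov w) \<Longrightarrow> w \<in> verts R \<Longrightarrow> map lift_arrow p \<in> paths R (lift_source w p) w"
proof (induction p arbitrary: i)
  case Nil
  then show ?case by (simp add: wf_digraph.paths_Nil[OF wf_split] lift_source_def)
next
  case (Cons a p)
  then have a: "a \<in> arcs Q" and p: "p \<in> paths Q (head Q a) (ov w)" by (simp_all add: paths_Cons)
  \<comment> \<open>The remaining path starts at the head of an arrow, which is not
    \<open>v\<close>; its lift therefore starts at an unsplit vertex and can be joined to the lift
    of \<open>a\<close>.\<close>
  have "lift_source w p = Old (head Q a)"
    using lift_source_verts[OF p Cons.prems(2)] old_vertex head_ne_v[OF a] by metis
  then show ?case
    using Cons.IH[OF p] Cons.prems(2) a
    by (simp add: wf_digraph.paths_Cons[OF wf_split] lift_arrow_arcs head_lift_arrow lift_source_def)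
qed

text \<open>Forgetting the bars preserves length, so \<open>b\<close> also bounds the paths of
  \<open>R\<close>, and the description of the radical holds for \<open>R\<close> too.\<close>

sublocale S: bounded_quiver K R "split_dim v d" b
proof -
  interpret R: wf_digraph R by (rule wf_split)
  have "finite (arcs Q - (A \<union> B))" "finite A" "finite B" "finite (verts Q - {v})"
    using blocks_tail by (auto intro: finite_subset[OF _ finite_arcs])
  then have "finite (verts R)" "finite (arcs R)" by (simp_all add: split_quiver_def)
  moreover have "length p \<le> b" if "p \<in> paths R u w" for u w p
    using orig_path[OF that] bounded by fastforce
  ultimately show "bounded_quiver K R b" by unfold_locales auto
qed

section \<open>Identification of the fibres\<close>

lemma split_dim: "w \<in> verts R \<Longrightarrow> split_dim v d w = d (ov w)"
  by (cases w) (simp_all add: split_dim_def)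

lemma split_sources: "in_arcs R SplitA = {}" "in_arcs R SplitB = {}"
  by (auto simp: in_arcs_def split_arcs(4))

text \<open>A relabelling of coordinates along the bijection of paths. The copy
  \<open>(v, r)\<close> is distributed over \<open>(SplitA, r)\<close> and
  \<open>(SplitB, r)\<close> according to the first arrow, which is why both new vertices get
  multiplicity \<open>d v\<close>. The fibre at \<open>v\<close> itself is identified with the fibre
  at either copy.\<close>

definition to_split where
  "to_split w x = S.vec w (\<lambda>u r p. x (ov u, r) (map orig_arrow p))"

definition of_split where
  "of_split w y = vec (ov w) (\<lambda>i r p. y (lift_source w p, r) (map lift_arrow p))"

lemma split_coeffD:
  assumes "u \<in> verts R" "r < split_dim v d u" "p \<in> paths R u w"
  shows "ov u \<in> verts Q" "r < d (ov u)" "map orig_arrow p \<in> paths Q (ov u) (ov w)"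
    "lift_source w (map orig_arrow p) = u" "map (lift_arrow \<circ> orig_arrow) p = p"
  using assms orig_path[OF assms(3)] by (simp_all add: split_dim split_verts)

lemma lift_coeffD:
  assumes "w \<in> verts R" "r < d i" "p \<in> paths Q i (ov w)"
  shows "lift_source w p \<in> verts R" "r < split_dim v d (lift_source w p)"
    "map lift_arrow p \<in> paths R (lift_source w p) w" "ov (lift_source w p) = i"
  using assms lift_source_verts[OF assms(3,1)] lift_path[OF assms(3,1)] by (simp_all add: split_dim)

lemma to_split_coeff:
  "u \<in> verts R \<Longrightarrow> r < split_dim v d u \<Longrightarrow> p \<in> paths R u w \<Longrightarrow>
    to_split w x (u, r) p = x (ov u, r) (map orig_arrow p)"
  by (simp add: to_split_def)

lemma of_split_coeff:
  "i \<in> verts Q \<Longrightarrow> r < d i \<Longrightarrow> p \<in> paths Q i (ov w) \<Longrightarrow>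
    of_split w y (i, r) p = y (lift_source w p, r) (map lift_arrow p)"
  by (simp add: of_split_def)

lemma to_split_closed:
  "x \<in> carrier (vspace P (ov w)) \<Longrightarrow> to_split w x \<in> carrier (vspace S.P w)"
  unfolding to_split_def by (rule S.vec_in_P) (auto intro!: P_coeff dest: split_coeffD)

lemma of_split_closed:
  "w \<in> verts R \<Longrightarrow> y \<in> carrier (vspace S.P w) \<Longrightarrow> of_split w y \<in> carrier (vspace P (ov w))"
  unfolding of_split_def by (rule vec_in_P) (auto intro!: S.P_coeff dest: lift_coeffD)

lemma to_of_split:
  assumes "w \<in> verts R" "y \<in> carrier (vspace S.P w)"
  shows "to_split w (of_split w y) = y"
proof (rule S.P_ext[OF to_split_closed[OF of_split_closed[OF assms]] assms(2)])
  fix u r p assume *: "u \<in> verts R" "r < split_dim v d u" "p \<in> paths R u w"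
  then show "to_split w (of_split w y) (u, r) p = y (u, r) p"
    using split_coeffD[OF *] by (simp add: to_split_coeff of_split_coeff)
qed

lemma of_to_split:
  assumes "w \<in> verts R" "x \<in> carrier (vspace P (ov w))"
  shows "of_split w (to_split w x) = x"
proof (rule P_ext[OF of_split_closed[OF assms(1) to_split_closed[OF assms(2)]] assms(2)])
  fix i r p assume *: "i \<in> verts Q" "r < d i" "p \<in> paths Q i (ov w)"
  then show "of_split w (to_split w x) (i, r) p = x (i, r) p"
    using lift_coeffD[OF assms(1) *(2,3)] by (simp add: to_split_coeff of_split_coeff comp_def)
qed

lemma to_split_add:
  "x \<in> carrier (vspace P (ov w)) \<Longrightarrow> y \<in> carrier (vspace P (ov w)) \<Longrightarrow>
    to_split w (x \<oplus>\<^bsub>vspace P (ov w)\<^esub> y) = to_split w x \<oplus>\<^bsub>vspace S.P w\<^esub> to_split w y"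
  by (rule S.P_ext[of _ w])
    (simp_all add: to_split_closed P_closed S.P_closed S.P_add_coeff,
      simp add: to_split_coeff P_add_coeff split_coeffD)

lemma to_split_smult:
  "c \<in> carrier K \<Longrightarrow> x \<in> carrier (vspace P (ov w)) \<Longrightarrow>
    to_split w (c \<odot>\<^bsub>vspace P (ov w)\<^esub> x) = c \<odot>\<^bsub>vspace S.P w\<^esub> to_split w x"
  by (rule S.P_ext[of _ w])
    (simp_all add: to_split_closed P_closed S.P_closed S.P_smult_coeff,
      simp add: to_split_coeff P_smult_coeff split_coeffD)

lemma to_split_zero: "to_split w \<zero>\<^bsub>vspace P (ov w)\<^esub> = \<zero>\<^bsub>vspace S.P w\<^esub>"
  by (rule S.P_ext[of _ w])
    (simp_all add: to_split_closed P_closed S.P_closed S.P_zero_coeff,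
      simp add: to_split_coeff P_zero_coeff split_coeffD)

lemma to_split_action:
  assumes e: "e \<in> arcs R" and x: "x \<in> carrier (vspace P (tail Q (orig_arrow e)))"
  shows "to_split (head R e) (action P (orig_arrow e) x) = action S.P e (to_split (tail R e) x)"
proof (rule S.P_ext)
  show "to_split (head R e) (action P (orig_arrow e) x) \<in> carrier (vspace S.P (head R e))"
    using P_action_closed[OF x] by (intro to_split_closed) (simp add: ov_head[OF e])
  have tx: "to_split (tail R e) x \<in> carrier (vspace S.P (tail R e))"
    using x by (intro to_split_closed) (simp add: split_arcs[OF e])
  then show "action S.P e (to_split (tail R e) x) \<in> carrier (vspace S.P (head R e))"
    by (rule S.P_action_closed)
  fix u r p assume *: "u \<in> verts R" "r < split_dim v d u" "p \<in> paths R u (head R e)"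
  note D = split_coeffD[OF *]
  show "to_split (head R e) (action P (orig_arrow e) x) (u, r) p
      = action S.P e (to_split (tail R e) x) (u, r) p"
  proof (cases "p = []")
    case True
    then show ?thesis
      using * D by (simp add: to_split_coeff P_action[OF x] S.P_action[OF tx] ov_head[OF e])
  next
    case False
    then have l: "last p \<in> arcs R" and "butlast p \<in> paths R u (tail R (last p))"
      using S.butlast_paths[OF *(3)] by auto
    \<comment> \<open>On arrows of \<open>R\<close>, \<open>lift_arrow\<close> inverts
      \<open>orig_arrow\<close>; thus ending in \<open>e\<close> above and ending in its image below
      are the same condition.\<close>
    moreover have "orig_arrow (last p) = orig_arrow e \<longleftrightarrow> last p = e"
      using split_arcs(5)[OF l] split_arcs(5)[OF e] by metis
    ultimately show ?thesis
      using * D False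
      by (cases "last p = e") (simp_all add: to_split_coeff P_action[OF x] S.P_action[OF tx] ov_head[OF e] last_map map_butlast)
  qed
qed

text \<open>Transported from \<open>to_split\<close>, of which \<open>of_split\<close> is the
  two-sided inverse; the laws below for multiples, zero and arrows arise likewise.\<close>

lemma of_split_add:
  assumes w: "w \<in> verts R" and x: "x \<in> carrier (vspace S.P w)" and y: "y \<in> carrier (vspace S.P w)"
  shows "of_split w (x \<oplus>\<^bsub>vspace S.P w\<^esub> y) = of_split w x \<oplus>\<^bsub>vspace P (ov w)\<^esub> of_split w y"
  using to_split_add[OF of_split_closed[OF w x] of_split_closed[OF w y]] x y w
    of_to_split[OF w P_closed(1)[OF of_split_closed[OF w x] of_split_closed[OF w y]]]
  by (simp add: to_of_split)

lemma of_split_smult: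
  assumes w: "w \<in> verts R" and c: "c \<in> carrier K" and x: "x \<in> carrier (vspace S.P w)"
  shows "of_split w (c \<odot>\<^bsub>vspace S.P w\<^esub> x) = c \<odot>\<^bsub>vspace P (ov w)\<^esub> of_split w x"
  using to_split_smult[OF c of_split_closed[OF w x]] x w
    of_to_split[OF w P_closed(3)[OF c of_split_closed[OF w x]]]
  by (simp add: to_of_split)

lemma of_split_zero: "w \<in> verts R \<Longrightarrow> of_split w \<zero>\<^bsub>vspace S.P w\<^esub> = \<zero>\<^bsub>vspace P (ov w)\<^esub>"
  using of_to_split[OF _ P_closed(2)] by (simp add: to_split_zero)

lemma of_split_action:
  assumes e: "e \<in> arcs R" and y: "y \<in> carrier (vspace S.P (tail R e))"
  shows "of_split (head R e) (action S.P e y) = action P (orig_arrow e) (of_split (tail R e) y)"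
proof -
  note D = split_arcs[OF e]
  have x: "of_split (tail R e) y \<in> carrier (vspace P (tail Q (orig_arrow e)))"
    using of_split_closed[OF D(2) y] D(3) by simp
  have "head R e \<in> verts R" using e by simp
  from of_to_split[OF this, of "action P (orig_arrow e) (of_split (tail R e) y)"]
  show ?thesis
    using to_split_action[OF e x] P_action_closed[OF x] by (simp add: ov_head[OF e] to_of_split[OF D(2) y])
qed

text \<open>The relabelling matches the constant path at \<open>w\<close> with the one at
  \<open>ov w\<close>.\<close>

lemma to_split_layer_1:
  assumes w: "w \<in> verts R" and x: "x \<in> layer (Suc 0) (ov w)"
  shows "to_split w x \<in> S.layer (Suc 0) w"
  using w x to_split_closed[OF layer_carrier[OF x]] split_verts[of w]
  by (simp add: layer_1_iff S.layer_1_iff split_dim)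
    (simp add: to_split_coeff split_dim S.paths_Nil)

lemma of_split_layer_1:
  assumes w: "w \<in> verts R" and y: "y \<in> S.layer (Suc 0) w"
  shows "of_split w y \<in> layer (Suc 0) (ov w)"
  using w y of_split_closed[OF w S.layer_carrier[OF y]] split_verts[of w]
  by (simp add: layer_1_iff S.layer_1_iff split_dim)
    (simp add: of_split_coeff lift_source_def paths_Nil)

section \<open>Transport of endomorphisms by conjugation\<close>

definition split_map where
  "split_map f = (\<lambda>w\<in>verts R. \<lambda>y\<in>carrier (vspace S.P w). to_split w (f (ov w) (of_split w y)))"

lemma split_map_apply:
  "w \<in> verts R \<Longrightarrow> y \<in> carrier (vspace S.P w) \<Longrightarrow>
    split_map f w y = to_split w (f (ov w) (of_split w y))"
  by (simp add: split_map_def)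

lemma ov_verts: "w \<in> verts R \<Longrightarrow> ov w \<in> verts Q"
  by (simp add: split_verts)

text \<open>The component of \<open>f\<close> at \<open>v\<close> serves at both
  \<open>SplitA\<close> and \<open>SplitB\<close>. This works for every endomorphism of
  \<open>P\<close>; restriction to the radicals is what makes the transport surjective.\<close>

lemma split_map_rep_hom:
  assumes f: "f \<in> rep_hom K Q P P"
  shows "split_map f \<in> rep_hom K R S.P S.P"
  unfolding split_map_def
proof (rule rep_homI, goal_cases)
  case (1 w x)
  then show ?case
    by (intro to_split_closed rep_homD(1)[OF f] of_split_closed) (simp_all add: ov_verts)
next
  case (2 w x y)
  then show ?case
    by (simp add: S.P_closed of_split_add rep_homD(1,2)[OF f] of_split_closed to_split_add ov_verts)
next
  case (3 w c x)
  then show ?case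
    by (simp add: S.P_closed of_split_smult rep_homD(1,3)[OF f] of_split_closed to_split_smult ov_verts)
next
  case (4 e x)
  note D = split_arcs[OF 4(1)]
  have x: "of_split (tail R e) x \<in> carrier (vspace P (tail Q (orig_arrow e)))"
    using of_split_closed[OF D(2) 4(2)] D(3) by simp
  then have "f (tail Q (orig_arrow e)) (of_split (tail R e) x)
      \<in> carrier (vspace P (tail Q (orig_arrow e)))"
    using D(1) by (intro rep_homD(1)[OF f]) simp_all
  then show ?case
    using 4 x D(1-3)
    by (simp add: S.P_action_closed of_split_action ov_head rep_homD(4)[OF f] to_split_action)
qed

lemma split_map_radical:
  assumes f: "f \<in> radical_maps"
  shows "split_map f \<in> S.radical_maps"
proof -
  have "split_map f w y \<in> S.layer (Suc 0) w"
    if w: "w \<in> verts R" and y: "y \<in> carrier (vspace S.P w)" for w y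
    using f of_split_closed[OF w y] ov_verts[OF w]
    by (auto simp: radical_maps_def split_map_apply[OF w y] intro!: to_split_layer_1[OF w])
  then show ?thesis
    using f split_map_rep_hom[of f] by (simp add: radical_maps_def S.radical_maps_def)
qed

text \<open>A section of \<open>ov\<close>. Over \<open>v\<close> the choice of
  \<open>SplitA\<close> is arbitrary; \<open>unsplit_map_apply\<close> shows that
  \<open>SplitB\<close> would give the same result on radical maps.\<close>

definition lift_vertex :: "'v \<Rightarrow> 'v split_vertex" where
  "lift_vertex j = (if j = v then SplitA else Old j)"

lemma lift_vertex: "j \<in> verts Q \<Longrightarrow> lift_vertex j \<in> verts R" "ov (lift_vertex j) = j"
  using v by (auto simp: lift_vertex_def split_verts)

definition unsplit_map where
  "unsplit_map g = (\<lambda>j\<in>verts Q. \<lambda>x\<in>carrier (vspace P j).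
    of_split (lift_vertex j) (g (lift_vertex j) (to_split (lift_vertex j) x)))"

text \<open>At the two copies of \<open>v\<close> both sides vanish, since a radical map kills the fibre at a source.\<close>

lemma unsplit_map_apply:
  assumes g: "g \<in> S.radical_maps" and w: "w \<in> verts R" and x: "x \<in> carrier (vspace P (ov w))"
  shows "unsplit_map g (ov w) x = of_split w (g w (to_split w x))"
proof (cases "w = lift_vertex (ov w)")
  case True
  then show ?thesis using w x by (simp add: unsplit_map_def ov_verts)
next
  case False
  then have wB: "w = SplitB"
    using old_vertex[OF w] w by (cases w) (auto simp: lift_vertex_def split_verts)
  have zero: "of_split u (g u (to_split u x)) = \<zero>\<^bsub>vspace P v\<^esub>"
    if u: "u \<in> {SplitA, SplitB}" for u
  proof -
    have uR: "u \<in> verts R" and ovu: "ov u = v" and src: "in_arcs R u = {}"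
      using u v split_sources by (auto simp: split_verts)
    have "to_split u x \<in> carrier (vspace S.P u)"
      using x ovu wB by (intro to_split_closed) simp
    then have "g u (to_split u x) \<in> S.layer (Suc 0) u"
      using g uR by (simp add: S.radical_maps_def)
    then show ?thesis
      using S.layer_1_source[OF src] of_split_zero[OF uR] ovu by simp
  qed
  then show ?thesis
    using x v wB by (simp add: unsplit_map_def lift_vertex_def)
qed

lemma unsplit_map_radical:
  assumes g: "g \<in> S.radical_maps"
  shows "unsplit_map g \<in> radical_maps"
proof -
  have gr: "g \<in> rep_hom K R S.P S.P" using g by (simp add: S.radical_maps_def)
  note ap = unsplit_map_apply[OF g lift_vertex(1), unfolded lift_vertex(2)]
  have L: "unsplit_map g j x \<in> layer (Suc 0) j"
    if j: "j \<in> verts Q" and x: "x \<in> carrier (vspace P j)" for j x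
  proof -
    note J = lift_vertex(1)[OF j]
    have "g (lift_vertex j) (to_split (lift_vertex j) x) \<in> S.layer (Suc 0) (lift_vertex j)"
      using g x J to_split_closed[of x "lift_vertex j"]
      by (simp add: S.radical_maps_def lift_vertex(2))
    from of_split_layer_1[OF J this] show ?thesis
      using j x by (simp add: ap lift_vertex(2))
  qed
  have "(\<lambda>j\<in>verts Q. \<lambda>x\<in>carrier (vspace P j). unsplit_map g j x) \<in> rep_hom K Q P P"
  proof (rule rep_homI, goal_cases)
    case (1 j x)
    then show ?case using L layer_carrier by blast
  next
    case (2 j x y)
    note J = lift_vertex(1)[OF 2(1)]
    have c: "to_split (lift_vertex j) z \<in> carrier (vspace S.P (lift_vertex j))"
      if "z \<in> carrier (vspace P j)" for z
      using to_split_closed[of z "lift_vertex j"] that by (simp add: lift_vertex(2))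
    show ?case
      using 2 J to_split_add[of x "lift_vertex j" y] of_split_add[OF J]
      by (simp add: P_closed ap lift_vertex(2) c rep_homD(1,2)[OF gr])
  next
    case (3 j a x)
    note J = lift_vertex(1)[OF 3(1)]
    have c: "to_split (lift_vertex j) x \<in> carrier (vspace S.P (lift_vertex j))"
      using to_split_closed[of x "lift_vertex j"] 3 by (simp add: lift_vertex(2))
    show ?case
      using 3 J to_split_smult[of a x "lift_vertex j"] of_split_smult[OF J]
      by (simp add: P_closed ap lift_vertex(2) c rep_homD(1,3)[OF gr])
  next
    case (4 a x)
    define e where "e = lift_arrow a"
    have e: "e \<in> arcs R" and a: "orig_arrow e = a"
      using 4 by (simp_all add: e_def lift_arrow_arcs)
    note D = split_arcs[OF e, unfolded a]
    have hR: "head R e \<in> verts R" using e by simp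
    have x: "to_split (tail R e) x \<in> carrier (vspace S.P (tail R e))"
      using 4 D(3) by (intro to_split_closed) simp
    have ax: "action P a x \<in> carrier (vspace P (head Q a))"
      using 4 by (intro P_action_closed)
    have "unsplit_map g (head Q a) (action P a x)
        = of_split (head R e) (g (head R e) (action S.P e (to_split (tail R e) x)))"
      using unsplit_map_apply[OF g hR, of "action P a x"] ax ov_head[OF e] a
        to_split_action[OF e, of x] 4 by simp
    also have "\<dots> = action P a (of_split (tail R e) (g (tail R e) (to_split (tail R e) x)))"
      using rep_homD(4)[OF gr e x] of_split_action[OF e rep_homD(1)[OF gr D(2) x]] a by simp
    \<comment> \<open>For \<open>a\<close> in \<open>B\<close> the lift starts at
      \<open>SplitB\<close>, whereas \<open>unsplit_map\<close> at \<open>v\<close> is defined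
      through \<open>SplitA\<close>; \<open>unsplit_map_apply\<close> permits the change of
      copy.\<close>
    also have "of_split (tail R e) (g (tail R e) (to_split (tail R e) x)) = unsplit_map g (tail Q a) x"
      using unsplit_map_apply[OF g D(2), of x] 4 D(3) by simp
    finally show ?case using 4 ax by simp
  qed
  moreover have "(\<lambda>j\<in>verts Q. \<lambda>x\<in>carrier (vspace P j). unsplit_map g j x) = unsplit_map g"
    by (auto simp: unsplit_map_def fun_eq_iff restrict_def)
  ultimately show ?thesis using L by (simp add: radical_maps_def)
qed

lemma bij_betw_split_map: "bij_betw split_map radical_maps S.radical_maps"
proof (rule bij_betw_byWitness[where f' = unsplit_map])
  show "\<forall>f\<in>radical_maps. unsplit_map (split_map f) = f"
  proof
    fix f assume f: "f \<in> radical_maps"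
    then have fr: "f \<in> rep_hom K Q P P" by (simp add: radical_maps_def)
    show "unsplit_map (split_map f) = f"
    proof (rule End_ext)
      show "unsplit_map (split_map f) \<in> rep_hom K Q P P"
        using unsplit_map_radical[OF split_map_radical[OF f]] by (simp add: radical_maps_def)
      fix j x assume *: "j \<in> verts Q" "x \<in> carrier (vspace P j)"
      note J = lift_vertex(1)[OF *(1)]
      show "unsplit_map (split_map f) j x = f j x"
        using * J to_split_closed[of x "lift_vertex j"] of_to_split[OF J] rep_homD(1)[OF fr]
        by (simp add: unsplit_map_def split_map_apply lift_vertex(2))
    qed (rule fr)
  qed
  show "\<forall>g\<in>S.radical_maps. split_map (unsplit_map g) = g"
  proof
    fix g assume g: "g \<in> S.radical_maps"
    then have gr: "g \<in> rep_hom K R S.P S.P" by (simp add: S.radical_maps_def)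
    show "split_map (unsplit_map g) = g"
    proof (rule S.End_ext)
      show "split_map (unsplit_map g) \<in> rep_hom K R S.P S.P"
        using split_map_radical[OF unsplit_map_radical[OF g]] by (simp add: S.radical_maps_def)
      fix w x assume *: "w \<in> verts R" "x \<in> carrier (vspace S.P w)"
      \<comment> \<open>At \<open>w = SplitB\<close> the left side was built from \<open>g\<close>
        at \<open>SplitA\<close>; the two agree because \<open>g\<close> is radical, again by
        \<open>unsplit_map_apply\<close>.\<close>
      then show "split_map (unsplit_map g) w x = g w x"
        by (simp add: split_map_apply unsplit_map_apply[OF g] of_split_closed to_of_split
            rep_homD(1)[OF gr])
    qed (rule gr)
  qed
qed (use split_map_radical unsplit_map_radical in blast)+

lemma ideals_isomorphic_split:
  "ideals_isomorphic K (A_alg K Q d) (jacobson_radical (A_alg K Q d))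
    (A_alg K R (split_dim v d)) (jacobson_radical (A_alg K R (split_dim v d)))"
  unfolding jacobson_radical_A_alg S.jacobson_radical_A_alg
  unfolding A_alg_def ideals_isomorphic_def
proof (intro exI conjI ballI)
  show "bij_betw split_map radical_maps S.radical_maps" by (rule bij_betw_split_map)
  fix f g assume "f \<in> radical_maps" "g \<in> radical_maps"
  then have f: "f \<in> rep_hom K Q P P" and g: "g \<in> rep_hom K Q P P"
    by (simp_all add: radical_maps_def)
  note maps = f g split_map_rep_hom[OF f] split_map_rep_hom[OF g]
  show "split_map (f \<oplus>\<^bsub>End_algebra K Q P\<^esub> g)
      = split_map f \<oplus>\<^bsub>End_algebra K R S.P\<^esub> split_map g"
  proof (rule S.End_ext[OF split_map_rep_hom[OF End_closed(1)[OF f g]]])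
    fix w y assume "w \<in> verts R" "y \<in> carrier (vspace S.P w)"
    then show "split_map (f \<oplus>\<^bsub>End_algebra K Q P\<^esub> g) w y
        = (split_map f \<oplus>\<^bsub>End_algebra K R S.P\<^esub> split_map g) w y"
      by (simp add: End_algebra_simps split_map_apply ov_verts of_split_closed to_split_add
          rep_homD(1)[OF f] rep_homD(1)[OF g])
  qed (intro S.End_closed maps)
  show "split_map (f \<otimes>\<^bsub>End_algebra K Q P\<^esub> g)
      = split_map f \<otimes>\<^bsub>End_algebra K R S.P\<^esub> split_map g"
  proof (rule S.End_ext[OF split_map_rep_hom[OF End_closed(2)[OF f g]]])
    fix w y assume "w \<in> verts R" "y \<in> carrier (vspace S.P w)"
    then show "split_map (f \<otimes>\<^bsub>End_algebra K Q P\<^esub> g) w y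
        = (split_map f \<otimes>\<^bsub>End_algebra K R S.P\<^esub> split_map g) w y"
      by (simp add: End_algebra_simps split_map_apply ov_verts of_split_closed to_split_closed
          of_to_split rep_homD(1)[OF f] rep_homD(1)[OF g])
  qed (intro S.End_closed maps)
next
  fix c f assume c: "c \<in> carrier K" and "f \<in> radical_maps"
  then have f: "f \<in> rep_hom K Q P P" by (simp add: radical_maps_def)
  show "split_map (c \<odot>\<^bsub>End_algebra K Q P\<^esub> f) = c \<odot>\<^bsub>End_algebra K R S.P\<^esub> split_map f"
    unfolding split_map_def End_algebra_simps
    by (intro restrict_ext)
      (simp add: c ov_verts of_split_closed to_split_smult rep_homD(1)[OF f])
qed

end

text \<open>The bijection is injective only on the radical. Closure under products puts
  \<open>x \<otimes> y\<close> and \<open>y \<otimes> x\<close> there, so that commuting is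
  reflected as well as preserved.\<close>

lemma commuting_rad_count_cong:
  assumes iso: "ideals_isomorphic K (A_alg K Q d) (jacobson_radical (A_alg K Q d))
      (A_alg K Q' d') (jacobson_radical (A_alg K Q' d'))"
    and closed: "\<And>x y. x \<in> jacobson_radical (A_alg K Q d) \<Longrightarrow> y \<in> jacobson_radical (A_alg K Q d) \<Longrightarrow>
      x \<otimes>\<^bsub>A_alg K Q d\<^esub> y \<in> jacobson_radical (A_alg K Q d)"
  shows "commuting_rad_count K Q d = commuting_rad_count K Q' d'"
proof -
  let ?I = "jacobson_radical (A_alg K Q d)" and ?J = "jacobson_radical (A_alg K Q' d')"
  obtain h where h: "bij_betw h ?I ?J"
    and mult: "\<And>x y. x \<in> ?I \<Longrightarrow> y \<in> ?I \<Longrightarrow>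
      h (x \<otimes>\<^bsub>A_alg K Q d\<^esub> y) = h x \<otimes>\<^bsub>A_alg K Q' d'\<^esub> h y"
    using iso unfolding ideals_isomorphic_def by blast
  let ?C = "{(x, y). x \<in> ?I \<and> y \<in> ?I \<and> x \<otimes>\<^bsub>A_alg K Q d\<^esub> y = y \<otimes>\<^bsub>A_alg K Q d\<^esub> x}"
  let ?D = "{(x, y). x \<in> ?J \<and> y \<in> ?J \<and> x \<otimes>\<^bsub>A_alg K Q' d'\<^esub> y = y \<otimes>\<^bsub>A_alg K Q' d'\<^esub> x}"
  have comm: "h x \<otimes>\<^bsub>A_alg K Q' d'\<^esub> h y = h y \<otimes>\<^bsub>A_alg K Q' d'\<^esub> h x \<longleftrightarrow>
      x \<otimes>\<^bsub>A_alg K Q d\<^esub> y = y \<otimes>\<^bsub>A_alg K Q d\<^esub> x" if "x \<in> ?I" "y \<in> ?I" for x y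
    using inj_on_eq_iff[OF bij_betw_imp_inj_on[OF h] closed[OF that] closed[OF that(2,1)]]
    by (simp add: mult that)
  have "inj_on (map_prod h h) ?C"
    using bij_betw_imp_inj_on[OF h] by (auto simp: inj_on_def)
  moreover have "map_prod h h ` ?C = ?D"
  proof
    show "map_prod h h ` ?C \<subseteq> ?D"
      using comm bij_betwE[OF h] by (auto simp only: map_prod_simp mem_Collect_eq case_prod_conv)
    show "?D \<subseteq> map_prod h h ` ?C"
    proof clarify
      fix x y assume xy: "x \<in> ?J" "y \<in> ?J"
        "x \<otimes>\<^bsub>A_alg K Q' d'\<^esub> y = y \<otimes>\<^bsub>A_alg K Q' d'\<^esub> x"
      then obtain x' y' where "x = h x'" "y = h y'" "x' \<in> ?I" "y' \<in> ?I"
        using bij_betw_imp_surj_on[OF h] by blast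
      moreover from this have "(x', y') \<in> ?C"
        using xy(3) comm[of x' y'] by simp
      ultimately show "(x, y) \<in> map_prod h h ` ?C"
        by (intro image_eqI[of _ _ "(x', y')"]) simp_all
    qed
  qed
  ultimately have "bij_betw (map_prod h h) ?C ?D" by (rule bij_betw_imageI)
  then show ?thesis
    unfolding commuting_rad_count_def by (rule bij_betw_same_card)
qed

theorem theorem3p18:
  fixes K :: "('k, 'r) ring_scheme"
    and Q :: "('v, 'e) pre_digraph"
    and v :: 'v
    and d :: "'v \<Rightarrow> nat"
    and A B :: "'e set"
  assumes "field K" and "finite (carrier K)"
    and "fin_digraph Q" and "\<nexists>c. pre_digraph.cycle Q c"
    and "v \<in> verts Q" and "in_arcs Q v = {}"
    and "A \<union> B = out_arcs Q v" and "A \<inter> B = {}"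
  shows "ideals_isomorphic K
      (A_alg K Q d) (jacobson_radical (A_alg K Q d))
      (A_alg K (split_quiver Q v A B) (split_dim v d))
      (jacobson_radical (A_alg K (split_quiver Q v A B) (split_dim v d)))
    \<and> commuting_rad_count K Q d
      = commuting_rad_count K (split_quiver Q v A B) (split_dim v d)"
proof -
  interpret field K by fact
  interpret fin_digraph Q by fact
  \<comment> \<open>In an acyclic quiver the number of vertices bounds the length of every
    path.\<close>
  interpret vertex_split K Q d "card (verts Q)" v A B
    using acyclic_path_length[OF assms(4)] assms(5-8) by unfold_locales auto
  have "x \<otimes>\<^bsub>A_alg K Q d\<^esub> y \<in> jacobson_radical (A_alg K Q d)"
    if "x \<in> jacobson_radical (A_alg K Q d)" "y \<in> jacobson_radical (A_alg K Q d)" for x y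
    using that radical_maps_mult[of x y] unfolding jacobson_radical_A_alg
    unfolding A_alg_def by (auto simp: radical_maps_def)
  then show ?thesis
    by (intro conjI ideals_isomorphic_split commuting_rad_count_cong[OF ideals_isomorphic_split])
qed

end
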